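(* Let $\tau>0$. On $H_3(\tau)$: (i) every maximal geodesic is one-to-one; (ii) a geodesic is isotropic if and only if its slope angle is $\theta=\pi/2$.
   Context: $H_3(\tau)$ (the Heisenberg group) is the connected, simply connected 3-dimensional Lie group whose Lie algebra has a basis $\{u_1,u_2,u_3\}$ with $[u_1,u_2]=\tau u_3$, $[u_2,u_3]=[u_3,u_1]=0$, equipped with the left-invariant Riemannian metric for which $\{u_1,u_2,u_3\}$ is orthonormal. $\xi=u_3$ is the Hopf vector field (a unit Killing field). The slope angle of a unit-speed geodesic $\gamma$ is the (constant) angle $\theta\in[0,\pi]$ between $\gamma'$ and $\xi$. A Jacobi field along a geodesic $\gamma$ is isotropic if it is the restriction to $\gamma$ of a Killing vector field. A point $\gamma(t)$ conjugate to $p=\gamma(0)$ along $\gamma$ is isotropic if some nonzero isotropic Jacobi field along $\gamma$ vanishes at $0$ and $t$. A geodesic $\gamma$ starting at $p$ is isotropic if every conjugate point to $p$ along $\gamma$ is isotropic (in particular this holds if there are no conjugate points). *)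

theory Defs
  imports "HOL-Analysis.Analysis"
begin

section \<open>Smooth maps and vector fields\<close>

text \<open>For maps between finite-dimensional spaces, being k + 1 times continuously differentiable
  amounts to being differentiable with all directional derivatives k times continuously
  differentiable.\<close>

primrec k_times_cont_diff :: "nat \<Rightarrow> ('a::real_normed_vector \<Rightarrow> 'b::real_normed_vector) \<Rightarrow> bool" where
  "k_times_cont_diff 0 f \<longleftrightarrow> continuous_on UNIV f"
| "k_times_cont_diff (Suc k) f \<longleftrightarrow>
     (\<forall>x. f differentiable (at x)) \<and>
     (\<forall>v. k_times_cont_diff k (\<lambda>x. frechet_derivative f (at x) v))"

definition smooth :: "('a::real_normed_vector \<Rightarrow> 'b::real_normed_vector) \<Rightarrow> bool" where
  "smooth f \<longleftrightarrow> (\<forall>k. k_times_cont_diff k f)"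

definition lie_bracket :: "('a::real_normed_vector \<Rightarrow> 'a) \<Rightarrow> ('a \<Rightarrow> 'a) \<Rightarrow> 'a \<Rightarrow> 'a" where
  "lie_bracket X Y p =
     frechet_derivative Y (at p) (X p) - frechet_derivative X (at p) (Y p)"


section \<open>Riemannian geometry in a global chart\<close>

text \<open>A metric on the manifold \<open>real^'n\<close> is a field \<open>g\<close> of symmetric positive definite
  Gram matrices with respect to the coordinate vector fields.\<close>

type_synonym 'n metric = "real^'n \<Rightarrow> real^'n^'n"

definition metric_ip :: "('n::finite) metric \<Rightarrow> real^'n \<Rightarrow> real^'n \<Rightarrow> real^'n \<Rightarrow> real" where
  "metric_ip g p v w = v \<bullet> (g p *v w)"

definition metric_norm :: "('n::finite) metric \<Rightarrow> real^'n \<Rightarrow> real^'n \<Rightarrow> real" where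
  "metric_norm g p v = sqrt (metric_ip g p v v)"

definition metric_angle :: "('n::finite) metric \<Rightarrow> real^'n \<Rightarrow> real^'n \<Rightarrow> real^'n \<Rightarrow> real" where
  "metric_angle g p v w = arccos (metric_ip g p v w / (metric_norm g p v * metric_norm g p w))"

definition partial :: "'n \<Rightarrow> (real^'n::finite \<Rightarrow> real) \<Rightarrow> real^'n \<Rightarrow> real" where
  "partial i f p = frechet_derivative f (at p) (axis i 1)"

text \<open>\<open>christoffel g k i j\<close> has upper index \<open>k\<close> and lower indices \<open>i\<close>, \<open>j\<close>.\<close>

definition christoffel :: "('n::finite) metric \<Rightarrow> 'n \<Rightarrow> 'n \<Rightarrow> 'n \<Rightarrow> real^'n \<Rightarrow> real" where
  "christoffel g k i j p =
     (\<Sum>l\<in>UNIV. matrix_inv (g p) $ k $ l *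
        (partial i (\<lambda>q. g q $ j $ l) p + partial j (\<lambda>q. g q $ i $ l) p
         - partial l (\<lambda>q. g q $ i $ j) p)) / 2"

text \<open>Sign convention: the curvature of X, Y applied to Z is
  \<open>\<nabla>\<^sub>X \<nabla>\<^sub>Y Z - \<nabla>\<^sub>Y \<nabla>\<^sub>X Z - \<nabla>\<^bsub>[X,Y]\<^esub> Z\<close>. In \<open>curvature_coeff g l k i j\<close>, the index \<open>l\<close> is that
  of the result, and \<open>i\<close>, \<open>j\<close>, \<open>k\<close> are those of X, Y, Z.\<close>

definition curvature_coeff ::
  "('n::finite) metric \<Rightarrow> 'n \<Rightarrow> 'n \<Rightarrow> 'n \<Rightarrow> 'n \<Rightarrow> real^'n \<Rightarrow> real" where
  "curvature_coeff g l k i j p =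
     partial i (christoffel g l j k) p - partial j (christoffel g l i k) p
     + (\<Sum>m\<in>UNIV. christoffel g l i m p * christoffel g m j k p
                  - christoffel g l j m p * christoffel g m i k p)"

definition curvature ::
  "('n::finite) metric \<Rightarrow> real^'n \<Rightarrow> real^'n \<Rightarrow> real^'n \<Rightarrow> real^'n \<Rightarrow> real^'n" where
  "curvature g p X Y Z =
     (\<chi> l. \<Sum>i\<in>UNIV. \<Sum>j\<in>UNIV. \<Sum>k\<in>UNIV. curvature_coeff g l k i j p * X $ i * Y $ j * Z $ k)"

definition velocity :: "(real \<Rightarrow> real^'n::finite) \<Rightarrow> real \<Rightarrow> real^'n" where
  "velocity \<gamma> t = vector_derivative \<gamma> (at t)"

definition cov_deriv ::
  "('n::finite) metric \<Rightarrow> (real \<Rightarrow> real^'n) \<Rightarrow> (real \<Rightarrow> real^'n) \<Rightarrow> real \<Rightarrow> real^'n" where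
  "cov_deriv g \<gamma> V t =
     (\<chi> k. vector_derivative V (at t) $ k
        + (\<Sum>i\<in>UNIV. \<Sum>j\<in>UNIV. christoffel g k i j (\<gamma> t) * velocity \<gamma> t $ i * V t $ j))"

text \<open>In the next definitions the curves are total functions, but only their restriction to
  the open interval \<open>I\<close> matters. Constant geodesics are not excluded by \<open>geodesic_on\<close>.\<close>

definition geodesic_on :: "('n::finite) metric \<Rightarrow> real set \<Rightarrow> (real \<Rightarrow> real^'n) \<Rightarrow> bool" where
  "geodesic_on g I \<gamma> \<longleftrightarrow>
     open I \<and> is_interval I \<and> I \<noteq> {} \<and>
     (\<forall>t\<in>I. \<gamma> differentiable (at t) \<and> velocity \<gamma> differentiable (at t) \<and>
            cov_deriv g \<gamma> (velocity \<gamma>) t = 0)"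

definition maximal_geodesic_on :: "('n::finite) metric \<Rightarrow> real set \<Rightarrow> (real \<Rightarrow> real^'n) \<Rightarrow> bool" where
  "maximal_geodesic_on g I \<gamma> \<longleftrightarrow>
     geodesic_on g I \<gamma> \<and>
     (\<forall>J \<delta>. geodesic_on g J \<delta> \<and> I \<subseteq> J \<and> (\<forall>t\<in>I. \<delta> t = \<gamma> t) \<longrightarrow> J = I)"

definition unit_speed_on :: "('n::finite) metric \<Rightarrow> real set \<Rightarrow> (real \<Rightarrow> real^'n) \<Rightarrow> bool" where
  "unit_speed_on g I \<gamma> \<longleftrightarrow> (\<forall>t\<in>I. metric_norm g (\<gamma> t) (velocity \<gamma> t) = 1)"

definition jacobi_field_on ::
  "('n::finite) metric \<Rightarrow> real set \<Rightarrow> (real \<Rightarrow> real^'n) \<Rightarrow> (real \<Rightarrow> real^'n) \<Rightarrow> bool" where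
  "jacobi_field_on g I \<gamma> J \<longleftrightarrow>
     (\<forall>t\<in>I. J differentiable (at t) \<and> cov_deriv g \<gamma> J differentiable (at t) \<and>
            cov_deriv g \<gamma> (cov_deriv g \<gamma> J) t
              + curvature g (\<gamma> t) (J t) (velocity \<gamma> t) (velocity \<gamma> t) = 0)"

text \<open>The second condition is the vanishing of the Lie derivative of \<open>g\<close> along \<open>V\<close>, in coordinates.\<close>

definition killing_field :: "('n::finite) metric \<Rightarrow> (real^'n \<Rightarrow> real^'n) \<Rightarrow> bool" where
  "killing_field g V \<longleftrightarrow>
     smooth V \<and>
     (\<forall>p i j. (\<Sum>k\<in>UNIV. V p $ k * partial k (\<lambda>q. g q $ i $ j) p
                        + g p $ k $ j * partial i (\<lambda>q. V q $ k) p
                        + g p $ i $ k * partial j (\<lambda>q. V q $ k) p) = 0)"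

definition isotropic_jacobi_field_on ::
  "('n::finite) metric \<Rightarrow> real set \<Rightarrow> (real \<Rightarrow> real^'n) \<Rightarrow> (real \<Rightarrow> real^'n) \<Rightarrow> bool" where
  "isotropic_jacobi_field_on g I \<gamma> J \<longleftrightarrow>
     jacobi_field_on g I \<gamma> J \<and> (\<exists>V. killing_field g V \<and> (\<forall>t\<in>I. J t = V (\<gamma> t)))"

text \<open>Conjugate points are conjugate to \<open>\<gamma> 0\<close> along \<open>\<gamma>\<close>, and are given by their parameter \<open>t\<close>.\<close>

definition conjugate_along ::
  "('n::finite) metric \<Rightarrow> real set \<Rightarrow> (real \<Rightarrow> real^'n) \<Rightarrow> real \<Rightarrow> bool" where
  "conjugate_along g I \<gamma> t \<longleftrightarrow>
     0 \<in> I \<and> t \<in> I \<and> t \<noteq> 0 \<and>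
     (\<exists>J. jacobi_field_on g I \<gamma> J \<and> (\<exists>s\<in>I. J s \<noteq> 0) \<and> J 0 = 0 \<and> J t = 0)"

definition isotropic_conjugate_along ::
  "('n::finite) metric \<Rightarrow> real set \<Rightarrow> (real \<Rightarrow> real^'n) \<Rightarrow> real \<Rightarrow> bool" where
  "isotropic_conjugate_along g I \<gamma> t \<longleftrightarrow>
     conjugate_along g I \<gamma> t \<and>
     (\<exists>J. isotropic_jacobi_field_on g I \<gamma> J \<and> (\<exists>s\<in>I. J s \<noteq> 0) \<and> J 0 = 0 \<and> J t = 0)"

definition isotropic_geodesic ::
  "('n::finite) metric \<Rightarrow> real set \<Rightarrow> (real \<Rightarrow> real^'n) \<Rightarrow> bool" where
  "isotropic_geodesic g I \<gamma> \<longleftrightarrow>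
     (\<forall>t. conjugate_along g I \<gamma> t \<longrightarrow> isotropic_conjugate_along g I \<gamma> t)"


section \<open>The Heisenberg group\<close>

text \<open>The connected, simply connected group with Lie algebra \<open>[u\<^sub>1, u\<^sub>2] = \<tau> u\<^sub>3\<close>,
  \<open>[u\<^sub>2, u\<^sub>3] = [u\<^sub>3, u\<^sub>1] = 0\<close>, in exponential coordinates: the Baker-Campbell-Hausdorff formula
  terminates as \<open>p q = p + q + [p, q] / 2\<close>. The neutral element is \<open>0\<close> and the inverse of \<open>p\<close>
  is \<open>- p\<close>.\<close>

definition heis_mult :: "real \<Rightarrow> real^3 \<Rightarrow> real^3 \<Rightarrow> real^3" where
  "heis_mult \<tau> p q =
     vector [p$1 + q$1, p$2 + q$2, p$3 + q$3 + \<tau> / 2 * (p$1 * q$2 - p$2 * q$1)]"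

text \<open>The left-invariant vector field with value \<open>axis i 1\<close> at the neutral element.\<close>

definition heis_frame :: "real \<Rightarrow> 3 \<Rightarrow> real^3 \<Rightarrow> real^3" where
  "heis_frame \<tau> i p = frechet_derivative (heis_mult \<tau> p) (at 0) (axis i 1)"

text \<open>The metric for which \<open>heis_frame\<close> is orthonormal: if the columns of \<open>A\<close> are the frame vectors
  at a point, then the Gram matrix \<open>G\<close> there satisfies \<open>A\<^sup>T G A = 1\<close>.\<close>

definition heis_metric :: "real \<Rightarrow> 3 metric" where
  "heis_metric \<tau> p =
     (let B = matrix_inv (\<chi> j i. heis_frame \<tau> i p $ j) in transpose B ** B)"

definition hopf_field :: "real \<Rightarrow> real^3 \<Rightarrow> real^3" where
  "hopf_field \<tau> = heis_frame \<tau> 3"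

text \<open>The slope angle of \<open>\<gamma>\<close> on \<open>I\<close> is constantly \<open>\<theta>\<close>.\<close>

definition has_slope_angle :: "real \<Rightarrow> real set \<Rightarrow> (real \<Rightarrow> real^3) \<Rightarrow> real \<Rightarrow> bool" where
  "has_slope_angle \<tau> I \<gamma> \<theta> \<longleftrightarrow>
     (\<forall>t\<in>I. metric_angle (heis_metric \<tau>) (\<gamma> t) (velocity \<gamma> t) (hopf_field \<tau> (\<gamma> t)) = \<theta>)"


subsection \<open>The model has the required structure\<close>

lemma heis_mult_group:
  "heis_mult \<tau> (heis_mult \<tau> p q) r = heis_mult \<tau> p (heis_mult \<tau> q r)"
  "heis_mult \<tau> 0 p = p" "heis_mult \<tau> p 0 = p"
  "heis_mult \<tau> p (- p) = 0" "heis_mult \<tau> (- p) p = 0"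
  by (simp_all add: heis_mult_def vec_eq_iff forall_3 field_simps)

lemma heis_mult_has_derivative:
  "(heis_mult \<tau> p has_derivative
      (\<lambda>v. vector [v$1, v$2, v$3 + \<tau> / 2 * (p$1 * v$2 - p$2 * v$1)])) (at q)"
proof -
  define L :: "real^3 \<Rightarrow> real^3" where
    "L = (\<lambda>v. vector [v$1, v$2, v$3 + \<tau> / 2 * (p$1 * v$2 - p$2 * v$1)])"
  have "linear L"
    by (rule linearI) (simp_all add: L_def vec_eq_iff forall_3 field_simps)
  then have "((\<lambda>q. p + L q) has_derivative L) (at q)"
    by (auto intro!: derivative_eq_intros linear_imp_has_derivative)
  moreover have "heis_mult \<tau> p = (\<lambda>q. p + L q)"
    by (rule ext) (simp add: heis_mult_def L_def vec_eq_iff forall_3)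
  ultimately show ?thesis by (simp add: L_def)
qed

lemma frechet_derivative_heis_mult:
  "frechet_derivative (heis_mult \<tau> p) (at q) v =
     vector [v$1, v$2, v$3 + \<tau> / 2 * (p$1 * v$2 - p$2 * v$1)]"
  by (simp add: heis_mult_has_derivative[THEN frechet_derivative_at, symmetric])

lemma heis_frame_left_invariant:
  "frechet_derivative (heis_mult \<tau> p) (at q) (heis_frame \<tau> i q) = heis_frame \<tau> i (heis_mult \<tau> p q)"
  unfolding heis_frame_def frechet_derivative_heis_mult
  by (simp add: heis_mult_def vec_eq_iff forall_3 algebra_simps)

lemma heis_frame_eq:
  "heis_frame \<tau> 1 p = vector [1, 0, - \<tau> / 2 * p$2]"
  "heis_frame \<tau> 2 p = vector [0, 1, \<tau> / 2 * p$1]"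
  "heis_frame \<tau> 3 p = vector [0, 0, 1]"
  by (simp_all add: heis_frame_def frechet_derivative_heis_mult vec_eq_iff forall_3 axis_def)

lemma heis_frame_has_derivative:
  "(heis_frame \<tau> 1 has_derivative (\<lambda>v. vector [0, 0, - \<tau> / 2 * v$2])) (at p)"
  "(heis_frame \<tau> 2 has_derivative (\<lambda>v. vector [0, 0, \<tau> / 2 * v$1])) (at p)"
  "(heis_frame \<tau> 3 has_derivative (\<lambda>v. 0)) (at p)"
proof -
  define L M :: "real^3 \<Rightarrow> real^3" where
    "L = (\<lambda>v. vector [0, 0, - \<tau> / 2 * v$2])" and "M = (\<lambda>v. vector [0, 0, \<tau> / 2 * v$1])"
  have "linear L" "linear M"
    by (auto intro!: linearI simp: L_def M_def vec_eq_iff forall_3 algebra_simps)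
  then have 1: "((\<lambda>q. axis 1 1 + L q) has_derivative L) (at p)"
    and 2: "((\<lambda>q. axis 2 1 + M q) has_derivative M) (at p)"
    by (auto intro!: derivative_eq_intros linear_imp_has_derivative)
  have "heis_frame \<tau> 1 = (\<lambda>q. axis 1 1 + L q)" "heis_frame \<tau> 2 = (\<lambda>q. axis 2 1 + M q)"
    by (rule ext, simp add: heis_frame_eq L_def M_def vec_eq_iff forall_3 axis_def)+
  with 1 2 show
    "(heis_frame \<tau> 1 has_derivative (\<lambda>v. vector [0, 0, - \<tau> / 2 * v$2])) (at p)"
    "(heis_frame \<tau> 2 has_derivative (\<lambda>v. vector [0, 0, \<tau> / 2 * v$1])) (at p)"
    by (simp_all add: L_def M_def)
  have "heis_frame \<tau> 3 = (\<lambda>q. vector [0, 0, 1])"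
    by (rule ext) (simp add: heis_frame_eq)
  then show "(heis_frame \<tau> 3 has_derivative (\<lambda>v. 0)) (at p)"
    by simp
qed

lemma heis_frame_bracket:
  "lie_bracket (heis_frame \<tau> 1) (heis_frame \<tau> 2) p = \<tau> *\<^sub>R heis_frame \<tau> 3 p"
  "lie_bracket (heis_frame \<tau> 2) (heis_frame \<tau> 3) p = 0"
  "lie_bracket (heis_frame \<tau> 3) (heis_frame \<tau> 1) p = 0"
  by (simp_all add: lie_bracket_def heis_frame_has_derivative[THEN frechet_derivative_at, symmetric])
     (simp_all add: heis_frame_eq vec_eq_iff forall_3)

lemma heis_metric_orthonormal:
  "metric_ip (heis_metric \<tau>) p (heis_frame \<tau> i p) (heis_frame \<tau> j p) = (if i = j then 1 else 0)"
proof -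
  define A :: "real^3^3" where "A = (\<chi> j i. heis_frame \<tau> i p $ j)"
  have "det A = 1"
    by (simp add: A_def det_3 heis_frame_eq)
  then have "invertible A"
    by (simp add: invertible_det_nz)
  then have "matrix_inv A ** A = mat 1"
    unfolding invertible_def matrix_inv_def by (rule someI2_ex) blast
  then have inv: "matrix_inv A *v (A *v v) = v" for v
    by (simp add: matrix_vector_mul_assoc)
  have "A *v axis k 1 = heis_frame \<tau> k p" for k
    by (simp add: A_def matrix_vector_mult_basis column_def vec_eq_iff)
  then have 1: "matrix_inv A *v heis_frame \<tau> k p = axis k 1" for k
    using inv[of "axis k 1"] by simp
  have 2: "x \<bullet> ((transpose B ** B) *v y) = (B *v x) \<bullet> (B *v y)"
    for x y :: "real^3" and B :: "real^3^3"
  proof -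
    have "x \<bullet> ((transpose B ** B) *v y) = ((B *v y) v* B) \<bullet> x"
      by (simp only: matrix_vector_mul_assoc[symmetric] transpose_matrix_vector inner_commute)
    also have "\<dots> = (B *v y) \<bullet> (B *v x)"
      by (rule dot_lmul_matrix)
    finally show ?thesis
      by (simp only: inner_commute)
  qed
  show ?thesis
    unfolding metric_ip_def heis_metric_def A_def[symmetric] Let_def 2 1
    by (simp add: inner_axis_axis)
qed

end

theory Submission
  imports Defs
begin

text \<open>Write \<open>v\<close> for the velocity of a geodesic in the left-invariant frame and \<open>c\<close> for its vertical
  component. The geodesic equation says that \<open>c\<close> is constant and the horizontal part of \<open>v\<close> rotates
  with angular velocity \<open>\<omega> = \<tau> c\<close>, so every geodesic is a helix defined for all times. If two of its points
  coincide then their projections do, and the height gained meanwhile has the sign of \<open>c\<close>, because the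
  projection encloses its circle in the direction given by \<open>c\<close>; hence the helix is injective.

  The Killing fields are spanned by right-invariant fields and a rotation. One that vanishes at
  \<open>\<gamma> 0\<close> is a multiple of the rotation about the fibre through \<open>\<gamma> 0\<close>, so an isotropic conjugate point of
  \<open>\<gamma> 0\<close> lies on this fibre while \<open>\<gamma>\<close> itself is not vertical. The Jacobi equation can be solved
  explicitly. For \<open>c = 0\<close> there are no conjugate points. A vertical geodesic has one. For every other
  geodesic, with horizontal speed \<open>r\<close>, any solution \<open>s\<close> of \<open>r\<^sup>2 s cos s = (c\<^sup>2 + r\<^sup>2) sin s\<close> with
  \<open>\<pi> < s < 3 \<pi> / 2\<close> gives a conjugate point at time \<open>2 s / \<omega>\<close>, and this point is not on the fibre of
  \<open>\<gamma> 0\<close>.\<close>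

subsection \<open>Partial derivatives\<close>

lemma partial_eqI: "(f has_derivative f') (at p) \<Longrightarrow> partial i f p = f' (axis i 1)"
  by (simp add: partial_def frechet_derivative_at[symmetric])

lemma differentiable_vec_nth [simp]: "(\<lambda>q::real^'n. q $ i) differentiable (at p)"
  using bounded_linear_vec_nth bounded_linear_imp_differentiable by blast

lemma partial_const [simp]: "partial i (\<lambda>q. c) p = 0"
  by (simp add: partial_def frechet_derivative_const)

lemma partial_vec_nth [simp]: "partial i (\<lambda>q. q $ j) p = (if i = j then 1 else 0)"
  by (subst partial_eqI[OF bounded_linear_imp_has_derivative[OF bounded_linear_vec_nth]])
     (simp add: axis_def)

lemma partial_add:
  "f differentiable (at p) \<Longrightarrow> g differentiable (at p) \<Longrightarrow>
    partial i (\<lambda>q. f q + g q) p = partial i f p + partial i g p"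
  by (rule partial_eqI[THEN trans, OF has_derivative_add])
     (auto simp: partial_def frechet_derivative_works)

lemma partial_diff:
  "f differentiable (at p) \<Longrightarrow> g differentiable (at p) \<Longrightarrow>
    partial i (\<lambda>q. f q - g q) p = partial i f p - partial i g p"
  by (rule partial_eqI[THEN trans, OF has_derivative_diff])
     (auto simp: partial_def frechet_derivative_works)

lemma partial_minus:
  "f differentiable (at p) \<Longrightarrow> partial i (\<lambda>q. - f q) p = - partial i f p"
  by (rule partial_eqI[THEN trans, OF has_derivative_minus])
     (auto simp: partial_def frechet_derivative_works)

lemma partial_mult:
  "f differentiable (at p) \<Longrightarrow> g differentiable (at p) \<Longrightarrow>
    partial i (\<lambda>q. f q * g q) p = f p * partial i g p + partial i f p * g p"
  by (rule partial_eqI[THEN trans, OF has_derivative_mult])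
     (auto simp: partial_def frechet_derivative_works)

lemma partial_power2:
  "f differentiable (at p) \<Longrightarrow> partial i (\<lambda>q. (f q)\<^sup>2) p = 2 * f p * partial i f p"
  by (simp add: power2_eq_square partial_mult)

lemmas partial_simps = partial_add partial_diff partial_minus partial_mult partial_power2
  differentiable_add differentiable_diff differentiable_minus differentiable_mult
  differentiable_power differentiable_const

subsection \<open>The metric, the connection and the curvature\<close>

text \<open>\<open>matrix_inv\<close> is a choice among two-sided inverses, so one explicit inverse
  determines it by uniqueness.\<close>

lemma matrix_inv_eqI:
  fixes A B :: "real^'n^'n"
  assumes "A ** B = mat 1" "B ** A = mat 1"
  shows "matrix_inv A = B"
proof -
  have "A ** matrix_inv A = mat 1"
    using assms unfolding matrix_inv_def by (rule_tac someI2[of _ B]) auto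
  then have "B ** (A ** matrix_inv A) = B" by simp
  then show ?thesis by (simp add: matrix_mul_assoc assms)
qed

text \<open>The rescaling \<open>\<tau> = 2 k\<close> makes all structure constants below integral.\<close>

definition nil_metric :: "real \<Rightarrow> 3 metric" where
  "nil_metric k = heis_metric (2 * k)"

text \<open>The rows of the inverted frame matrix are the dual coframe \<open>dx\<close>,
  \<open>dy\<close>, \<open>dz + k (y dx - x dy)\<close>; the metric is the sum of their
  squares.\<close>

lemma nil_metric_eq:
  "nil_metric k p = vector
     [vector [1 + k\<^sup>2 * (p$2)\<^sup>2, - k\<^sup>2 * p$1 * p$2, k * p$2],
      vector [- k\<^sup>2 * p$1 * p$2, 1 + k\<^sup>2 * (p$1)\<^sup>2, - k * p$1],
      vector [k * p$2, - k * p$1, 1]]"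
proof -
  have "matrix_inv (\<chi> j i. heis_frame (2 * k) i p $ j) =
      vector [vector [1, 0, 0], vector [0, 1, 0], vector [k * p$2, - k * p$1, 1 :: real]]"
    by (rule matrix_inv_eqI)
       (simp_all add: vec_eq_iff forall_3 matrix_matrix_mult_def sum_3 heis_frame_eq mat_def)
  then show ?thesis
    unfolding nil_metric_def heis_metric_def Let_def
    by (simp add: vec_eq_iff forall_3 matrix_matrix_mult_def sum_3 transpose_def power2_eq_square)
qed

lemma matrix_inv_nil_metric:
  "matrix_inv (nil_metric k p) = vector
     [vector [1, 0, - k * p$2],
      vector [0, 1, k * p$1],
      vector [- k * p$2, k * p$1, 1 + k\<^sup>2 * ((p$1)\<^sup>2 + (p$2)\<^sup>2)]]"
  by (rule matrix_inv_eqI; simp add: nil_metric_eq vec_eq_iff forall_3 matrix_matrix_mult_def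
      sum_3 mat_def power2_eq_square algebra_simps)

text \<open>The symbols are given as functions, not as values at a point, because the curvature
  differentiates them.\<close>

lemma nil_christoffel:
  "christoffel (nil_metric k) 1 1 1 = (\<lambda>p. 0)"
  "christoffel (nil_metric k) 1 1 2 = (\<lambda>p. k^2 * p$2)"
  "christoffel (nil_metric k) 1 1 3 = (\<lambda>p. 0)"
  "christoffel (nil_metric k) 1 2 1 = (\<lambda>p. k^2 * p$2)"
  "christoffel (nil_metric k) 1 2 2 = (\<lambda>p. - (2 * k^2 * p$1))"
  "christoffel (nil_metric k) 1 2 3 = (\<lambda>p. k)"
  "christoffel (nil_metric k) 1 3 1 = (\<lambda>p. 0)"
  "christoffel (nil_metric k) 1 3 2 = (\<lambda>p. k)"
  "christoffel (nil_metric k) 1 3 3 = (\<lambda>p. 0)"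
  "christoffel (nil_metric k) 2 1 1 = (\<lambda>p. - (2 * k^2 * p$2))"
  "christoffel (nil_metric k) 2 1 2 = (\<lambda>p. k^2 * p$1)"
  "christoffel (nil_metric k) 2 1 3 = (\<lambda>p. - k)"
  "christoffel (nil_metric k) 2 2 1 = (\<lambda>p. k^2 * p$1)"
  "christoffel (nil_metric k) 2 2 2 = (\<lambda>p. 0)"
  "christoffel (nil_metric k) 2 2 3 = (\<lambda>p. 0)"
  "christoffel (nil_metric k) 2 3 1 = (\<lambda>p. - k)"
  "christoffel (nil_metric k) 2 3 2 = (\<lambda>p. 0)"
  "christoffel (nil_metric k) 2 3 3 = (\<lambda>p. 0)"
  "christoffel (nil_metric k) 3 1 1 = (\<lambda>p. - (2 * k^3 * p$1 * p$2))"
  "christoffel (nil_metric k) 3 1 2 = (\<lambda>p. k^3 * (p$1)^2 - k^3 * (p$2)^2)"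
  "christoffel (nil_metric k) 3 1 3 = (\<lambda>p. - (k^2 * p$1))"
  "christoffel (nil_metric k) 3 2 1 = (\<lambda>p. k^3 * (p$1)^2 - k^3 * (p$2)^2)"
  "christoffel (nil_metric k) 3 2 2 = (\<lambda>p. 2 * k^3 * p$1 * p$2)"
  "christoffel (nil_metric k) 3 2 3 = (\<lambda>p. - (k^2 * p$2))"
  "christoffel (nil_metric k) 3 3 1 = (\<lambda>p. - (k^2 * p$1))"
  "christoffel (nil_metric k) 3 3 2 = (\<lambda>p. - (k^2 * p$2))"
  "christoffel (nil_metric k) 3 3 3 = (\<lambda>p. 0)"
  unfolding fun_eq_iff christoffel_def sum_3 matrix_inv_nil_metric
  by (simp_all add: nil_metric_eq partial_simps field_simps power2_eq_square power3_eq_cube)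

text \<open>This is the differential of left translation by \<open>p\<close> for
  \<open>\<tau> = 2 * k\<close>. It turns components in the left-invariant frame into coordinates;
  \<open>frame_coords\<close> goes back.\<close>

definition frame_vec :: "real \<Rightarrow> real^3 \<Rightarrow> real^3 \<Rightarrow> real^3" where
  "frame_vec k p w = vector [w$1, w$2, w$3 + k * (p$1 * w$2 - p$2 * w$1)]"

definition frame_coords :: "real \<Rightarrow> real^3 \<Rightarrow> real^3 \<Rightarrow> real^3" where
  "frame_coords k p u = vector [u$1, u$2, u$3 - k * (p$1 * u$2 - p$2 * u$1)]"

lemma frame_vec_coords [simp]: "frame_vec k p (frame_coords k p u) = u"
  by (simp add: frame_vec_def frame_coords_def vec_eq_iff forall_3)

lemma frame_coords_vec [simp]: "frame_coords k p (frame_vec k p w) = w"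
  by (simp add: frame_vec_def frame_coords_def vec_eq_iff forall_3)

lemma frame_vec_eq_0_iff [simp]: "frame_vec k p w = 0 \<longleftrightarrow> w = 0"
  by (auto simp add: frame_vec_def vec_eq_iff forall_3)

text \<open>\<open>frame_conn k v w\<close> is the covariant derivative of the left-invariant field \<open>w\<close> along \<open>v\<close>.\<close>

definition frame_conn :: "real \<Rightarrow> real^3 \<Rightarrow> real^3 \<Rightarrow> real^3" where
  "frame_conn k v w = vector
     [k * (v$2 * w$3 + v$3 * w$2), - k * (v$1 * w$3 + v$3 * w$1), k * (v$1 * w$2 - v$2 * w$1)]"

lemma has_vector_derivative_vec_nth:
  "(f has_vector_derivative f') F \<Longrightarrow> ((\<lambda>t. f t $ i) has_vector_derivative f' $ i) F"
  by (rule bounded_linear.has_vector_derivative[OF bounded_linear_vec_nth])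

lemma has_vector_derivative_vector3:
  fixes f :: "real \<Rightarrow> real^3"
  assumes "((\<lambda>t. f t $ 1) has_real_derivative a) (at t)"
    "((\<lambda>t. f t $ 2) has_real_derivative b) (at t)" "((\<lambda>t. f t $ 3) has_real_derivative c) (at t)"
  shows "(f has_vector_derivative vector [a, b, c]) (at t)"
proof -
  have "((\<lambda>t. (f t $ 1) *\<^sub>R axis 1 1 + (f t $ 2) *\<^sub>R axis 2 1 + (f t $ 3) *\<^sub>R (axis 3 1 :: real^3))
      has_vector_derivative a *\<^sub>R axis 1 1 + b *\<^sub>R axis 2 1 + c *\<^sub>R axis 3 1) (at t)"
    using assms by (auto intro!: derivative_eq_intros)
  moreover have "(\<lambda>t. (f t $ 1) *\<^sub>R axis 1 1 + (f t $ 2) *\<^sub>R axis 2 1 + (f t $ 3) *\<^sub>R axis 3 1) = f"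
    by (simp add: fun_eq_iff vec_eq_iff forall_3 axis_def)
  moreover have "a *\<^sub>R axis 1 1 + b *\<^sub>R axis 2 1 + c *\<^sub>R axis 3 1 = (vector [a, b, c] :: real^3)"
    by (simp add: vec_eq_iff forall_3 axis_def)
  ultimately show ?thesis by simp
qed

lemma has_real_derivative_vec_nth:
  "(f has_vector_derivative f') F \<Longrightarrow> ((\<lambda>t. f t $ i) has_real_derivative f' $ i) F"
  unfolding has_real_derivative_iff_has_vector_derivative by (rule has_vector_derivative_vec_nth)

text \<open>The extra vertical term of this product rule comes from the variation of the frame along
  the base curve.\<close>

lemma has_vector_derivative_frame_vec:
  assumes "(\<gamma> has_vector_derivative u) (at t)" "(w has_vector_derivative w') (at t)"
  shows "((\<lambda>s. frame_vec k (\<gamma> s) (w s)) has_vector_derivative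
    frame_vec k (\<gamma> t) w' + (k * (u$1 * w t $ 2 - u$2 * w t $ 1)) *\<^sub>R axis 3 1) (at t)"
proof -
  note D = has_real_derivative_vec_nth[OF assms(1)] has_real_derivative_vec_nth[OF assms(2)]
  have "((\<lambda>s. frame_vec k (\<gamma> s) (w s)) has_vector_derivative vector
    [w' $ 1, w' $ 2, w' $ 3 + k * (u$1 * w t $ 2 + \<gamma> t $ 1 * w' $ 2 - (u$2 * w t $ 1 + \<gamma> t $ 2 * w' $ 1))]) (at t)"
    unfolding frame_vec_def
    by (rule has_vector_derivative_vector3)
       (auto intro!: derivative_eq_intros D simp: algebra_simps)
  then show ?thesis
    by (rule has_vector_derivative_eq_rhs)
       (simp add: frame_vec_def vec_eq_iff forall_3 axis_def algebra_simps)
qed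

lemma has_vector_derivative_frame_coords:
  assumes "(\<gamma> has_vector_derivative u) (at t)" "(V has_vector_derivative V') (at t)"
  shows "((\<lambda>s. frame_coords k (\<gamma> s) (V s)) has_vector_derivative
    frame_coords k (\<gamma> t) V' - (k * (u$1 * V t $ 2 - u$2 * V t $ 1)) *\<^sub>R axis 3 1) (at t)"
proof -
  note D = has_real_derivative_vec_nth[OF assms(1)] has_real_derivative_vec_nth[OF assms(2)]
  have "((\<lambda>s. frame_coords k (\<gamma> s) (V s)) has_vector_derivative vector
    [V' $ 1, V' $ 2, V' $ 3 - k * (u$1 * V t $ 2 + \<gamma> t $ 1 * V' $ 2 - (u$2 * V t $ 1 + \<gamma> t $ 2 * V' $ 1))]) (at t)"
    unfolding frame_coords_def
    by (rule has_vector_derivative_vector3)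
       (auto intro!: derivative_eq_intros D simp: algebra_simps)
  then show ?thesis
    by (rule has_vector_derivative_eq_rhs)
       (simp add: frame_coords_def vec_eq_iff forall_3 axis_def algebra_simps)
qed

text \<open>Left invariance removes the base point: in the frame the connection has constant
  coefficients, so the geodesic and Jacobi equations become equations for frame components
  alone.\<close>

lemma cov_deriv_frame_vec:
  assumes \<gamma>: "(\<gamma> has_vector_derivative frame_vec k (\<gamma> t) v) (at t)"
    and w: "(w has_vector_derivative w') (at t)"
  shows "cov_deriv (nil_metric k) \<gamma> (\<lambda>s. frame_vec k (\<gamma> s) (w s)) t =
    frame_vec k (\<gamma> t) (w' + frame_conn k v (w t))"
  unfolding cov_deriv_def velocity_def vector_derivative_at[OF \<gamma>]
    vector_derivative_at[OF has_vector_derivative_frame_vec[OF \<gamma> w]]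
  by (simp add: frame_vec_def frame_conn_def vec_eq_iff forall_3 sum_3 nil_christoffel axis_def;
      simp add: algebra_simps eval_nat_numeral)

text \<open>Horizontal planes have sectional curvature \<open>- 3 * k\<^sup>2\<close>, planes
  containing the vertical direction have \<open>k\<^sup>2\<close>.\<close>

lemma nil_curvature:
  "curvature (nil_metric k) p (frame_vec k p w) (frame_vec k p v) (frame_vec k p v) =
   frame_vec k p (vector
     [- 3 * k\<^sup>2 * (w$1 * v$2 - w$2 * v$1) * v$2 + k\<^sup>2 * (w$1 * v$3 - w$3 * v$1) * v$3,
      3 * k\<^sup>2 * (w$1 * v$2 - w$2 * v$1) * v$1 + k\<^sup>2 * (w$2 * v$3 - w$3 * v$2) * v$3,
      - k\<^sup>2 * (w$1 * v$3 - w$3 * v$1) * v$1 - k\<^sup>2 * (w$2 * v$3 - w$3 * v$2) * v$2])"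
  by (simp add: curvature_def curvature_coeff_def frame_vec_def vec_eq_iff forall_3 sum_3 nil_christoffel
      partial_simps; simp add: algebra_simps eval_nat_numeral)

subsection \<open>Geodesics\<close>

lemma DERIV_zero_interval_eq:
  fixes f :: "real \<Rightarrow> real"
  assumes "is_interval I" "\<And>t. t \<in> I \<Longrightarrow> (f has_real_derivative 0) (at t)" "s \<in> I" "t \<in> I"
  shows "f s = f t"
  using has_field_derivative_zero_constant[of I f] assms
  by (metis has_field_derivative_at_within is_interval_convex)

text \<open>As \<open>frame_conn\<close> does not see the base point, the frame velocity satisfies
  an autonomous quadratic equation and can be found before the curve itself.\<close>

lemma geodesic_on_frame:
  assumes "geodesic_on (nil_metric k) I \<gamma>" "t \<in> I"
  defines "v \<equiv> \<lambda>t. frame_coords k (\<gamma> t) (velocity \<gamma> t)"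
  shows "(\<gamma> has_vector_derivative frame_vec k (\<gamma> t) (v t)) (at t)"
    and "(v has_vector_derivative - frame_conn k (v t) (v t)) (at t)"
proof -
  have d: "(\<gamma> has_vector_derivative velocity \<gamma> t) (at t)" "velocity \<gamma> differentiable (at t)"
    and c: "cov_deriv (nil_metric k) \<gamma> (velocity \<gamma>) t = 0"
    using assms vector_derivative_works unfolding geodesic_on_def velocity_def by auto
  have vel: "velocity \<gamma> = (\<lambda>s. frame_vec k (\<gamma> s) (v s))"
    by (simp add: v_def)
  show 1: "(\<gamma> has_vector_derivative frame_vec k (\<gamma> t) (v t)) (at t)"
    using d(1) by (simp add: v_def)
  obtain v' where 2: "(v has_vector_derivative v') (at t)"
    unfolding v_def using has_vector_derivative_frame_coords[OF d(1)] d(2) vector_derivative_works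
    by blast
  then have "v' + frame_conn k (v t) (v t) = 0"
    using c cov_deriv_frame_vec[OF 1 2] unfolding vel by simp
  then have "v' = - frame_conn k (v t) (v t)"
    by (simp add: eq_neg_iff_add_eq_0)
  with 2 show "(v has_vector_derivative - frame_conn k (v t) (v t)) (at t)" by simp
qed

text \<open>For \<open>\<omega> = 0\<close> division by zero turns \<open>vers\<close> and \<open>vers_int\<close> into the zero function, which is still the
  antiderivative of \<open>sin (\<omega> t)\<close> and \<open>vers \<omega> t\<close>; only \<open>sinw\<close> needs a case distinction.\<close>

definition sinw :: "real \<Rightarrow> real \<Rightarrow> real" where
  "sinw \<omega> t = (if \<omega> = 0 then t else sin (\<omega> * t) / \<omega>)"

definition vers :: "real \<Rightarrow> real \<Rightarrow> real" where
  "vers \<omega> t = (1 - cos (\<omega> * t)) / \<omega>"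

definition vers_int :: "real \<Rightarrow> real \<Rightarrow> real" where
  "vers_int \<omega> t = (t - sin (\<omega> * t) / \<omega>) / \<omega>"

lemma DERIV_sinw: "(sinw \<omega> has_real_derivative cos (\<omega> * t)) (at t)"
  by (cases "\<omega> = 0"; auto simp: sinw_def[abs_def] intro!: derivative_eq_intros)

lemma DERIV_vers: "(vers \<omega> has_real_derivative sin (\<omega> * t)) (at t)"
  by (cases "\<omega> = 0"; auto simp: vers_def[abs_def] intro!: derivative_eq_intros)

lemma DERIV_vers_int: "(vers_int \<omega> has_real_derivative vers \<omega> t) (at t)"
  by (cases "\<omega> = 0"; auto simp: vers_int_def[abs_def] vers_def intro!: derivative_eq_intros)

text \<open>Up to the squared horizontal speed, this is the rate at which the projection of a helix
  sweeps out twice the area around its starting point.\<close>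

lemma sinw_vers: "sinw \<omega> t * sin (\<omega> * t) - vers \<omega> t * cos (\<omega> * t) = vers \<omega> t"
proof (cases "\<omega> = 0")
  case False
  have "sin (\<omega> * t) * sin (\<omega> * t) - (1 - cos (\<omega> * t)) * cos (\<omega> * t) = 1 - cos (\<omega> * t)"
    using sin_cos_squared_add[of "\<omega> * t"] by (simp add: power2_eq_square algebra_simps)
  with False show ?thesis
    by (simp add: sinw_def vers_def diff_divide_distrib[symmetric])
qed (simp add: sinw_def vers_def)

text \<open>The solution of the frame velocity equation with initial value \<open>v\<close>.\<close>

definition rot_vec :: "real \<Rightarrow> real^3 \<Rightarrow> real \<Rightarrow> real^3" where
  "rot_vec k v t = vector
     [v$1 * cos (2 * k * v$3 * t) - v$2 * sin (2 * k * v$3 * t),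
      v$1 * sin (2 * k * v$3 * t) + v$2 * cos (2 * k * v$3 * t), v$3]"

text \<open>\<open>(X, Y)\<close> integrates the horizontal part of \<open>rot_vec\<close>. The last
  summand of the height is \<open>k\<close> times twice the area swept by \<open>(X, Y)\<close>
  around the starting point.\<close>

definition helix :: "real \<Rightarrow> real^3 \<Rightarrow> real^3 \<Rightarrow> real \<Rightarrow> real^3" where
  "helix k a v t =
    (let \<omega> = 2 * k * v$3; X = v$1 * sinw \<omega> t - v$2 * vers \<omega> t; Y = v$1 * vers \<omega> t + v$2 * sinw \<omega> t
     in vector [a$1 + X, a$2 + Y,
       a$3 + v$3 * t + k * (a$1 * Y - a$2 * X) + k * ((v$1)\<^sup>2 + (v$2)\<^sup>2) * vers_int \<omega> t])"

lemma helix_0: "helix k a v 0 = a"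
  by (simp add: helix_def Let_def sinw_def vers_def vers_int_def vec_eq_iff forall_3)

lemma rot_vec_has_derivative:
  "(rot_vec k v has_vector_derivative - frame_conn k (rot_vec k v t) (rot_vec k v t)) (at t)"
proof -
  define \<omega> where "\<omega> = 2 * k * v$3"
  have "(rot_vec k v has_vector_derivative vector
      [- (\<omega> * rot_vec k v t $ 2), \<omega> * rot_vec k v t $ 1, 0]) (at t)"
    by (rule has_vector_derivative_vector3; simp add: rot_vec_def flip: \<omega>_def)
       (auto intro!: derivative_eq_intros simp: algebra_simps)
  then show ?thesis
    by (rule has_vector_derivative_eq_rhs)
       (simp add: frame_conn_def vec_eq_iff forall_3 \<omega>_def rot_vec_def)
qed

lemma helix_has_derivative:
  "(helix k a v has_vector_derivative frame_vec k (helix k a v t) (rot_vec k v t)) (at t)"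
proof -
  define \<omega> where "\<omega> = 2 * k * v$3"
  note D = DERIV_sinw[of \<omega> t] DERIV_vers[of \<omega> t] DERIV_vers_int[of \<omega> t]
  define X' where "X' = v$1 * cos (\<omega> * t) - v$2 * sin (\<omega> * t)"
  define Y' where "Y' = v$1 * sin (\<omega> * t) + v$2 * cos (\<omega> * t)"
  have *: "(helix k a v has_vector_derivative vector [X', Y',
      v$3 + k * (a$1 * Y' - a$2 * X') + k * ((v$1)\<^sup>2 + (v$2)\<^sup>2) * vers \<omega> t]) (at t)"
    unfolding helix_def Let_def \<omega>_def[symmetric] X'_def Y'_def
    by (rule has_vector_derivative_vector3; simp)
       (auto intro!: derivative_eq_intros D simp: algebra_simps)
  \<comment> \<open>The left side is \<open>X Y' - Y X'\<close>, twice the areal velocity.\<close>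
  have "(v$1 * sinw \<omega> t - v$2 * vers \<omega> t) * Y' - (v$1 * vers \<omega> t + v$2 * sinw \<omega> t) * X' =
     ((v$1)\<^sup>2 + (v$2)\<^sup>2) * (sinw \<omega> t * sin (\<omega> * t) - vers \<omega> t * cos (\<omega> * t))"
    unfolding X'_def Y'_def by (simp add: algebra_simps power2_eq_square)
  note area = this[unfolded sinw_vers]
  have "frame_vec k (helix k a v t) (rot_vec k v t) = vector [X', Y', v$3 + k * (a$1 * Y' - a$2 * X') +
      k * ((v$1 * sinw \<omega> t - v$2 * vers \<omega> t) * Y' - (v$1 * vers \<omega> t + v$2 * sinw \<omega> t) * X')]"
    unfolding helix_def Let_def rot_vec_def \<omega>_def[symmetric] X'_def[symmetric] Y'_def[symmetric]
      frame_vec_def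
    by (simp add: vec_eq_iff forall_3 algebra_simps)
  with * show ?thesis
    unfolding area by (simp add: mult.assoc)
qed

lemma velocity_helix: "velocity (helix k a v) = (\<lambda>t. frame_vec k (helix k a v t) (rot_vec k v t))"
  by (rule ext) (simp add: velocity_def vector_derivative_at[OF helix_has_derivative])

lemma helix_geodesic: "geodesic_on (nil_metric k) UNIV (helix k a v)"
proof -
  have "helix k a v differentiable (at t)" for t
    using helix_has_derivative differentiableI_vector by blast
  moreover have "velocity (helix k a v) differentiable (at t)" for t
    unfolding velocity_helix
    by (rule differentiableI_vector,
        rule has_vector_derivative_frame_vec[OF helix_has_derivative rot_vec_has_derivative])
  moreover have "cov_deriv (nil_metric k) (helix k a v) (velocity (helix k a v)) t = 0" for t
    unfolding velocity_helix
    by (subst cov_deriv_frame_vec[OF helix_has_derivative rot_vec_has_derivative]) simp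
  ultimately show ?thesis
    by (simp add: geodesic_on_def)
qed

text \<open>Uniqueness is obtained from first integrals: the vertical velocity, the horizontal
  velocity rotated back, and the left translation that carries a model helix to the curve. Time
  \<open>0\<close> need not lie in \<open>I\<close>, but the helix is defined there anyway.\<close>

lemma geodesic_on_eq_helix:
  assumes "geodesic_on (nil_metric k) I \<gamma>"
  shows "\<exists>a v. \<forall>t\<in>I. \<gamma> t = helix k a v t"
proof -
  have I: "is_interval I" and ne: "I \<noteq> {}"
    using assms by (auto simp: geodesic_on_def)
  then obtain s0 where s0: "s0 \<in> I" by blast
  define u where "u = (\<lambda>t. frame_coords k (\<gamma> t) (velocity \<gamma> t))"
  have ut: "frame_coords k (\<gamma> t) (velocity \<gamma> t) = u t" for t
    by (simp add: u_def)
  note D = geodesic_on_frame[OF assms, folded u_def, unfolded ut]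
  note Du = D(2)[THEN has_real_derivative_vec_nth]
  have c: "u t $ 3 = u s0 $ 3" if "t \<in> I" for t
    by (rule DERIV_zero_interval_eq[OF I _ that s0])
       (use Du[of _ 3] in \<open>simp add: frame_conn_def\<close>)
  define c where "c = u s0 $ 3"
  define \<omega> where "\<omega> = 2 * k * c"
  have Du1: "((\<lambda>t. u t $ 1) has_real_derivative - \<omega> * u t $ 2) (at t)"
    and Du2: "((\<lambda>t. u t $ 2) has_real_derivative \<omega> * u t $ 1) (at t)" if "t \<in> I" for t
    using Du[OF that, of 1] Du[OF that, of 2] c[OF that]
    by (simp_all add: frame_conn_def \<omega>_def c_def mult_ac)
  \<comment> \<open>\<open>(p, q)\<close> is the horizontal velocity rotated back by the angle
    \<open>\<omega> * t\<close>, hence constant.\<close>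
  define p where "p = (\<lambda>t. u t $ 1 * cos (\<omega> * t) + u t $ 2 * sin (\<omega> * t))"
  define q where "q = (\<lambda>t. u t $ 2 * cos (\<omega> * t) - u t $ 1 * sin (\<omega> * t))"
  have p: "p t = p s0" if "t \<in> I" for t
    by (rule DERIV_zero_interval_eq[OF I _ that s0])
       (auto simp: p_def intro!: derivative_eq_intros Du1 Du2)
  have q: "q t = q s0" if "t \<in> I" for t
    by (rule DERIV_zero_interval_eq[OF I _ that s0])
       (auto simp: q_def intro!: derivative_eq_intros Du1 Du2)
  define v :: "real^3" where "v = vector [p s0, q s0, c]"
  have v [simp]: "v$1 = p s0" "v$2 = q s0" "v$3 = c" by (simp_all add: v_def)
  have u1: "u t $ 1 = rot_vec k v t $ 1" and u2: "u t $ 2 = rot_vec k v t $ 2" if "t \<in> I" for t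
  proof -
    have "rot_vec k v t $ 1 = p t * cos (\<omega> * t) - q t * sin (\<omega> * t)"
      "rot_vec k v t $ 2 = p t * sin (\<omega> * t) + q t * cos (\<omega> * t)"
      using p[OF that] q[OF that] by (simp_all add: rot_vec_def \<omega>_def)
    moreover have "p t * cos (\<omega> * t) - q t * sin (\<omega> * t) =
        u t $ 1 * ((sin (\<omega> * t))\<^sup>2 + (cos (\<omega> * t))\<^sup>2)"
      "p t * sin (\<omega> * t) + q t * cos (\<omega> * t) = u t $ 2 * ((sin (\<omega> * t))\<^sup>2 + (cos (\<omega> * t))\<^sup>2)"
      by (simp_all add: p_def q_def algebra_simps power2_eq_square
          del: sin_cos_squared_add sin_cos_squared_add2 sin_cos_squared_add3)
    ultimately show "u t $ 1 = rot_vec k v t $ 1" "u t $ 2 = rot_vec k v t $ 2"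
      by (simp_all only: sin_cos_squared_add mult_1_right)
  qed
  have u: "u t = rot_vec k v t" if "t \<in> I" for t
    using u1[OF that] u2[OF that] c[OF that] by (simp add: vec_eq_iff forall_3 rot_vec_def c_def)
  note D\<gamma> = D(1)[THEN has_real_derivative_vec_nth]
  \<comment> \<open>The model helix starts at the neutral element and already has the right frame
    velocity.\<close>
  define h where "h = helix k 0 v"
  have Dh: "(h has_vector_derivative frame_vec k (h t) (rot_vec k v t)) (at t)" for t
    unfolding h_def by (rule helix_has_derivative)
  note Dh = Dh[THEN has_real_derivative_vec_nth]
  define x where "x = \<gamma> s0 $ 1 - h s0 $ 1"
  define y where "y = \<gamma> s0 $ 2 - h s0 $ 2"
  have x: "\<gamma> t $ 1 - h t $ 1 = x" if "t \<in> I" for t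
    unfolding x_def
    by (rule DERIV_zero_interval_eq[OF I _ that s0, of "\<lambda>t. \<gamma> t $ 1 - h t $ 1"])
       (auto intro!: derivative_eq_intros D\<gamma> Dh simp: u frame_vec_def)
  have y: "\<gamma> t $ 2 - h t $ 2 = y" if "t \<in> I" for t
    unfolding y_def
    by (rule DERIV_zero_interval_eq[OF I _ that s0, of "\<lambda>t. \<gamma> t $ 2 - h t $ 2"])
       (auto intro!: derivative_eq_intros D\<gamma> Dh simp: u frame_vec_def)
  \<comment> \<open>\<open>f\<close> is the height of the group element with horizontal part
    \<open>(x, y)\<close> that translates \<open>h t\<close> to \<open>\<gamma> t\<close>.\<close>
  define f where "f = (\<lambda>t. \<gamma> t $ 3 - h t $ 3 - k * (x * h t $ 2 - y * h t $ 1))"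
  have z: "f t = f s0" if "t \<in> I" for t
  proof (rule DERIV_zero_interval_eq[OF I _ that s0])
    fix t assume t: "t \<in> I"
    have "\<gamma> t $ 1 = h t $ 1 + x" "\<gamma> t $ 2 = h t $ 2 + y"
      using x[OF t] y[OF t] by simp_all
    then show "(f has_real_derivative 0) (at t)"
      unfolding f_def
      by (auto intro!: derivative_eq_intros D\<gamma> Dh t simp: u t frame_vec_def algebra_simps)
  qed
  have "\<gamma> t = helix k (vector [x, y, f s0]) v t" if "t \<in> I" for t
  proof -
    have "\<gamma> t = vector [x + h t $ 1, y + h t $ 2, f t + h t $ 3 + k * (x * h t $ 2 - y * h t $ 1)]"
      unfolding f_def using x[OF that] y[OF that] by (auto simp: vec_eq_iff forall_3)
    also have "\<dots> = helix k (vector [x, y, f s0]) v t"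
      unfolding z[OF that] by (simp add: h_def helix_def Let_def vec_eq_iff forall_3)
    finally show ?thesis .
  qed
  then show ?thesis by blast
qed

section \<open>Maximal geodesics and their injectivity\<close>

lemma maximal_geodesic_on_eq_helix:
  assumes "maximal_geodesic_on (nil_metric k) I \<gamma>"
  obtains a v where "I = UNIV" "\<gamma> = helix k a v"
proof -
  have g: "geodesic_on (nil_metric k) I \<gamma>"
    and max: "\<And>J \<delta>. geodesic_on (nil_metric k) J \<delta> \<Longrightarrow> I \<subseteq> J \<Longrightarrow> \<forall>t\<in>I. \<delta> t = \<gamma> t \<Longrightarrow> J = I"
    using assms by (auto simp: maximal_geodesic_on_def)
  obtain a v where av: "\<forall>t\<in>I. \<gamma> t = helix k a v t"
    using geodesic_on_eq_helix[OF g] by blast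
  \<comment> \<open>The helix is a geodesic on the whole line extending \<open>\<gamma>\<close>, so
    maximality leaves no smaller interval.\<close>
  then have "UNIV = I"
    using max[OF helix_geodesic[of k a v]] by auto
  moreover from this av have "\<gamma> = helix k a v" by auto
  ultimately show ?thesis using that by blast
qed

text \<open>Equal projections make \<open>r2 * sinw\<close> agree at both times. With the height
  equation this gives \<open>k * (2 * (v$3)\<^sup>2 + r2) * (s - t) = 0\<close>, where the factors
  before \<open>s - t\<close> are positive if \<open>v$3\<close> is nonzero. For
  \<open>v$3 = 0\<close> the projection is a straight line.\<close>

lemma inj_helix:
  assumes "k > 0" "v \<noteq> 0"
  shows "inj (helix k a v)"
proof (rule injI)
  fix s t assume eq: "helix k a v s = helix k a v t"
  define \<omega> where "\<omega> = 2 * k * v$3"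
  define X where "X = (\<lambda>t. v$1 * sinw \<omega> t - v$2 * vers \<omega> t)"
  define Y where "Y = (\<lambda>t. v$1 * vers \<omega> t + v$2 * sinw \<omega> t)"
  define r2 where "r2 = (v$1)\<^sup>2 + (v$2)\<^sup>2"
  have X: "X s = X t" and Y: "Y s = Y t"
    and "v$3 * s + k * (a$1 * Y s - a$2 * X s) + k * r2 * vers_int \<omega> s =
      v$3 * t + k * (a$1 * Y t - a$2 * X t) + k * r2 * vers_int \<omega> t"
    using eq unfolding helix_def Let_def \<omega>_def[symmetric] X_def Y_def r2_def
    by (auto simp: vec_eq_iff forall_3)
  then have Z: "v$3 * s + k * r2 * vers_int \<omega> s = v$3 * t + k * r2 * vers_int \<omega> t"
    by simp
  \<comment> \<open>Pairing the displacement with the initial velocity cancels the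
    \<open>vers\<close> terms.\<close>
  have "r2 * (sinw \<omega> s - sinw \<omega> t) = v$1 * (X s - X t) + v$2 * (Y s - Y t)"
    by (simp add: X_def Y_def r2_def algebra_simps power2_eq_square)
  then have S: "r2 * (sinw \<omega> s - sinw \<omega> t) = 0"
    using X Y by simp
  show "s = t"
  proof (cases "v$3 = 0")
    case True
    then have "r2 \<noteq> 0"
      using \<open>v \<noteq> 0\<close> by (auto simp: r2_def vec_eq_iff forall_3 sum_power2_eq_zero_iff)
    with S True show ?thesis by (simp add: sinw_def \<omega>_def)
  next
    case False
    then have \<omega>: "\<omega> \<noteq> 0" using \<open>k > 0\<close> by (simp add: \<omega>_def)
    have vi: "\<omega> * vers_int \<omega> t = t - sinw \<omega> t" for t
      using \<omega> by (simp add: vers_int_def sinw_def)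
    \<comment> \<open>This prepares the height equation multiplied by \<open>\<omega>\<close>, which
      turns \<open>vers_int\<close> into \<open>t - sinw \<omega> t\<close>; the last summand
      vanishes by \<open>S\<close>.\<close>
    have "k * (2 * (v$3)\<^sup>2 + r2) * (s - t) =
        \<omega> * (v$3 * (s - t)) + k * r2 * ((s - sinw \<omega> s) - (t - sinw \<omega> t))
        + k * (r2 * (sinw \<omega> s - sinw \<omega> t))"
      by (simp add: \<omega>_def algebra_simps power2_eq_square)
    also have "\<dots> = \<omega> * ((v$3 * s + k * r2 * vers_int \<omega> s) - (v$3 * t + k * r2 * vers_int \<omega> t))"
      unfolding S vi[symmetric] by (simp add: algebra_simps)
    also have "\<dots> = 0"
      unfolding Z by simp
    finally have "k * (2 * (v$3)\<^sup>2 + r2) * (s - t) = 0" .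
    moreover have "2 * (v$3)\<^sup>2 + r2 > 0"
      using False unfolding r2_def by (intro add_pos_nonneg) simp_all
    ultimately show ?thesis using \<open>k > 0\<close> by simp
  qed
qed

lemma helix_zero: "helix k a 0 = (\<lambda>t. a)"
  by (rule ext) (simp add: helix_def vec_eq_iff forall_3)

subsection \<open>Jacobi fields\<close>

text \<open>With \<open>C\<close> constant, this is the linearisation of the geodesic equation in the frame.\<close>

lemma jacobi_field_on_helixI:
  fixes k :: real and a v :: "real^3" and w1 w2 w3 b1 b2 :: "real \<Rightarrow> real" and C :: real
  defines "u \<equiv> rot_vec k v"
  assumes w1: "\<And>t. (w1 has_real_derivative b1 t) (at t)"
    and w2: "\<And>t. (w2 has_real_derivative b2 t) (at t)"
    and w3: "\<And>t. (w3 has_real_derivative C - 2 * k * (u t $ 1 * w2 t - u t $ 2 * w1 t)) (at t)"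
    and b1: "\<And>t. (b1 has_real_derivative - 2 * k * (v$3 * b2 t + u t $ 2 * C)) (at t)"
    and b2: "\<And>t. (b2 has_real_derivative 2 * k * (v$3 * b1 t + u t $ 1 * C)) (at t)"
  shows "jacobi_field_on (nil_metric k) UNIV (helix k a v)
           (\<lambda>t. frame_vec k (helix k a v t) (vector [w1 t, w2 t, w3 t]))"
proof -
  define w :: "real \<Rightarrow> real^3" where "w = (\<lambda>t. vector [w1 t, w2 t, w3 t])"
  define w' :: "real \<Rightarrow> real^3" where
    "w' = (\<lambda>t. vector [b1 t, b2 t, C - 2 * k * (u t $ 1 * w2 t - u t $ 2 * w1 t)])"
  \<comment> \<open>\<open>y\<close> holds the frame components of the covariant derivative of the
    field.\<close>
  define y where "y = (\<lambda>t. w' t + frame_conn k (u t) (w t))"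
  note D\<gamma> = helix_has_derivative[of k a v, folded u_def]
  have u3: "u t $ 3 = v $ 3" for t by (simp add: u_def rot_vec_def)
  have Du: "((\<lambda>t. u t $ i) has_real_derivative (- frame_conn k (u t) (u t)) $ i) (at t)" for t i
    unfolding u_def by (intro has_real_derivative_vec_nth rot_vec_has_derivative)
  have Du1: "((\<lambda>t. u t $ 1) has_real_derivative - 2 * k * u t $ 2 * v $ 3) (at t)"
    and Du2: "((\<lambda>t. u t $ 2) has_real_derivative 2 * k * u t $ 1 * v $ 3) (at t)" for t
    using Du[of 1 t] Du[of 2 t] by (simp_all add: frame_conn_def u3 mult_ac)
  have wt: "vector [w1 t, w2 t, w3 t] = w t" for t
    by (simp add: w_def)
  have Dw: "(w has_vector_derivative w' t) (at t)" for t
    unfolding w'_def by (rule has_vector_derivative_vector3; simp add: w_def w1 w2 w3)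
  have y: "y = (\<lambda>t. vector [b1 t + k * (u t $ 2 * w3 t + v $ 3 * w2 t),
      b2 t - k * (u t $ 1 * w3 t + v $ 3 * w1 t), C - k * (u t $ 1 * w2 t - u t $ 2 * w1 t)])"
    by (simp add: fun_eq_iff vec_eq_iff forall_3 y_def w'_def w_def frame_conn_def u3 algebra_simps)
  define w3' where "w3' = (\<lambda>t. C - 2 * k * (u t $ 1 * w2 t - u t $ 2 * w1 t))"
  define y' :: "real \<Rightarrow> real^3" where "y' = (\<lambda>t. vector
     [- 2 * k * (v$3 * b2 t + u t $ 2 * C) +
        k * (u t $ 2 * w3' t + 2 * k * u t $ 1 * v $ 3 * w3 t + v $ 3 * b2 t),
      2 * k * (v$3 * b1 t + u t $ 1 * C) -
        k * (u t $ 1 * w3' t - 2 * k * u t $ 2 * v $ 3 * w3 t + v $ 3 * b1 t),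
      - k * (u t $ 1 * b2 t - 2 * k * u t $ 2 * v $ 3 * w2 t
        - (u t $ 2 * b1 t + 2 * k * u t $ 1 * v $ 3 * w1 t))])"
  have w3: "(w3 has_real_derivative w3' t) (at t)" for t
    using assms(4) by (simp add: w3'_def)
  have Dy: "(y has_vector_derivative y' t) (at t)" for t
    unfolding y y'_def
    by (rule has_vector_derivative_vector3)
       (auto intro!: derivative_eq_intros w1 w2 w3 b1 b2 Du1 Du2 simp: algebra_simps)
  have cov1: "cov_deriv (nil_metric k) (helix k a v) (\<lambda>t. frame_vec k (helix k a v t) (w t)) =
      (\<lambda>t. frame_vec k (helix k a v t) (y t))"
    unfolding y_def by (rule ext, rule cov_deriv_frame_vec[OF D\<gamma> Dw])
  have cov2: "cov_deriv (nil_metric k) (helix k a v) (\<lambda>t. frame_vec k (helix k a v t) (y t)) t =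
      frame_vec k (helix k a v t) (y' t + frame_conn k (u t) (y t))" for t
    by (rule cov_deriv_frame_vec[OF D\<gamma> Dy])
  have eq: "y' t + frame_conn k (u t) (y t) + vector
     [- 3 * k\<^sup>2 * (w t $1 * u t $2 - w t $2 * u t $1) * u t $2 + k\<^sup>2 * (w t $1 * u t $3 - w t $3 * u t $1) * u t $3,
      3 * k\<^sup>2 * (w t $1 * u t $2 - w t $2 * u t $1) * u t $1 + k\<^sup>2 * (w t $2 * u t $3 - w t $3 * u t $2) * u t $3,
      - k\<^sup>2 * (w t $1 * u t $3 - w t $3 * u t $1) * u t $1 - k\<^sup>2 * (w t $2 * u t $3 - w t $3 * u t $2) * u t $2] = 0"
    for t
    unfolding y y'_def w_def w3'_def
    by (simp add: vec_eq_iff forall_3 frame_conn_def u3; simp add: algebra_simps power2_eq_square)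
  have "(\<lambda>t. frame_vec k (helix k a v t) (w t)) differentiable (at t)"
    "(\<lambda>t. frame_vec k (helix k a v t) (y t)) differentiable (at t)" for t
    using has_vector_derivative_frame_vec[OF D\<gamma> Dw] has_vector_derivative_frame_vec[OF D\<gamma> Dy]
      differentiableI_vector by blast+
  moreover have "frame_vec k p x + frame_vec k p z = frame_vec k p (x + z)" for p x z
    by (simp add: frame_vec_def vec_eq_iff forall_3 algebra_simps)
  ultimately show ?thesis
    unfolding jacobi_field_on_def wt cov1 cov2 velocity_helix nil_curvature
      u_def[symmetric]
    by (simp only: eq frame_vec_eq_0_iff) simp
qed

text \<open>Along a horizontal geodesic the component of a Jacobi field along the geodesic is affine,
  its horizontal normal component \<open>P\<close> satisfies \<open>P'' = 2 k |v|\<^sup>2 C\<close>, and its vertical component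
  has derivative \<open>C - 2 k P\<close>.\<close>

lemma jacobi_field_on_horizontal_eq_0:
  assumes J: "jacobi_field_on (nil_metric k) UNIV (helix k a v) J"
    and v: "v $ 3 = 0" "v \<noteq> 0" and T: "T \<noteq> 0" and J0: "J 0 = 0" "J T = 0"
  shows "J t = 0"
proof -
  define \<gamma> where "\<gamma> = helix k a v"
  have rot: "rot_vec k v = (\<lambda>t. v)"
    using v by (simp add: rot_vec_def fun_eq_iff vec_eq_iff forall_3)
  have D\<gamma>: "(\<gamma> has_vector_derivative frame_vec k (\<gamma> t) v) (at t)" for t
    using helix_has_derivative[of k a v] unfolding \<gamma>_def rot .
  define w where "w = (\<lambda>t. frame_coords k (\<gamma> t) (J t))"
  have Jw: "J = (\<lambda>t. frame_vec k (\<gamma> t) (w t))" by (simp add: w_def)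
  have w0: "w 0 = 0" "w T = 0"
    using J0 by (simp_all add: w_def frame_coords_def vec_eq_iff forall_3)
  have diff: "J differentiable (at t)" "cov_deriv (nil_metric k) \<gamma> J differentiable (at t)"
    and eq: "cov_deriv (nil_metric k) \<gamma> (cov_deriv (nil_metric k) \<gamma> J) t +
        curvature (nil_metric k) (\<gamma> t) (J t) (velocity \<gamma> t) (velocity \<gamma> t) = 0" for t
    using J by (auto simp: jacobi_field_on_def \<gamma>_def)
  define w' where "w' = (\<lambda>t. vector_derivative w (at t))"
  have Dw: "(w has_vector_derivative w' t) (at t)" for t
    unfolding w'_def vector_derivative_works[symmetric] w_def
    by (rule differentiableI_vector,
        rule has_vector_derivative_frame_coords[OF D\<gamma> diff(1)[unfolded vector_derivative_works]])
  define y where "y = (\<lambda>t. w' t + frame_conn k v (w t))"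
  have cov1: "cov_deriv (nil_metric k) \<gamma> J = (\<lambda>t. frame_vec k (\<gamma> t) (y t))"
    unfolding y_def Jw by (rule ext, rule cov_deriv_frame_vec[OF D\<gamma> Dw])
  define y' where "y' = (\<lambda>t. vector_derivative y (at t))"
  have y: "y = (\<lambda>t. frame_coords k (\<gamma> t) (cov_deriv (nil_metric k) \<gamma> J t))"
    by (simp add: cov1)
  have Dy: "(y has_vector_derivative y' t) (at t)" for t
    unfolding y'_def vector_derivative_works[symmetric] y
    by (rule differentiableI_vector,
        rule has_vector_derivative_frame_coords[OF D\<gamma> diff(2)[unfolded vector_derivative_works]])
  define P where "P = (\<lambda>t. v$1 * w t $ 2 - v$2 * w t $ 1)"
  define r2 where "r2 = (v$1)\<^sup>2 + (v$2)\<^sup>2"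
  have r2: "r2 > 0"
    using v by (auto simp: r2_def vec_eq_iff forall_3 sum_power2_gt_zero_iff)
  have add: "frame_vec k p x + frame_vec k p z = frame_vec k p (x + z)" for p x z
    by (simp add: frame_vec_def vec_eq_iff forall_3 algebra_simps)
  have vel: "velocity \<gamma> t = frame_vec k (\<gamma> t) v" for t
    by (simp add: velocity_def vector_derivative_at[OF D\<gamma>])
  have "cov_deriv (nil_metric k) \<gamma> (\<lambda>t. frame_vec k (\<gamma> t) (y t)) t =
      frame_vec k (\<gamma> t) (y' t + frame_conn k v (y t))" for t
    by (rule cov_deriv_frame_vec[OF D\<gamma> Dy])
  from eq[unfolded cov1 this vel, unfolded Jw nil_curvature add frame_vec_eq_0_iff]
  have e: "y' t + frame_conn k v (y t) + vector
     [- 3 * k\<^sup>2 * (w t $ 1 * v$2 - w t $ 2 * v$1) * v$2 + k\<^sup>2 * (w t $ 1 * v$3 - w t $ 3 * v$1) * v$3,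
      3 * k\<^sup>2 * (w t $ 1 * v$2 - w t $ 2 * v$1) * v$1 + k\<^sup>2 * (w t $ 2 * v$3 - w t $ 3 * v$2) * v$3,
      - k\<^sup>2 * (w t $ 1 * v$3 - w t $ 3 * v$1) * v$1 - k\<^sup>2 * (w t $ 2 * v$3 - w t $ 3 * v$2) * v$2] = 0"
    for t .
  have "y' t $ 1 + (k * v$2 * y t $ 3 + 3 * k\<^sup>2 * P t * v$2) = 0"
    "y' t $ 2 + - (k * v$1 * y t $ 3 + 3 * k\<^sup>2 * P t * v$1) = 0"
    "y' t $ 3 + (k * (v$1 * y t $ 2 - v$2 * y t $ 1) + k\<^sup>2 * r2 * w t $ 3) = 0" for t
    using arg_cong[OF e[of t], of "\<lambda>x. x $ 1"] arg_cong[OF e[of t], of "\<lambda>x. x $ 2"]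
      arg_cong[OF e[of t], of "\<lambda>x. x $ 3"]
    by (simp_all add: frame_conn_def v P_def r2_def algebra_simps power2_eq_square)
  then have y1': "y' t $ 1 = - (k * v$2 * y t $ 3 + 3 * k\<^sup>2 * P t * v$2)"
    and y2': "y' t $ 2 = k * v$1 * y t $ 3 + 3 * k\<^sup>2 * P t * v$1"
    and y3': "y' t $ 3 = - (k * (v$1 * y t $ 2 - v$2 * y t $ 1) + k\<^sup>2 * r2 * w t $ 3)" for t
    by (simp_all only: add_eq_0_iff2 minus_minus)
  have w1': "w' t $ 1 = y t $ 1 - k * v$2 * w t $ 3"
    and w2': "w' t $ 2 = y t $ 2 + k * v$1 * w t $ 3"
    and w3': "w' t $ 3 = y t $ 3 - k * P t" for t
    by (simp_all add: y_def frame_conn_def v P_def)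
  note D = Dw[THEN has_real_derivative_vec_nth] Dy[THEN has_real_derivative_vec_nth]
  \<comment> \<open>This is \<open>w\<^sub>3' + 2 k P\<close>, the first variation of the conserved
    vertical velocity.\<close>
  define C where "C = y 0 $ 3 + k * P 0"
  have C: "y t $ 3 + k * P t = C" for t
    unfolding C_def P_def
    by (rule DERIV_isconst_all[of "\<lambda>t. y t $ 3 + k * (v$1 * w t $ 2 - v$2 * w t $ 1)" t 0], rule allI, (rule derivative_eq_intros D refl)+)
       (simp add: w1' w2' y3' r2_def algebra_simps power2_eq_square)
  have y3: "y t $ 3 = C - k * P t" for t using C[of t] by simp
  \<comment> \<open>\<open>\<alpha>\<close> is the slope of the affine tangential component, whose
    zeros at \<open>0\<close> and \<open>T\<close> will force it to vanish.\<close>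
  define \<alpha> where "\<alpha> = v$1 * w' 0 $ 1 + v$2 * w' 0 $ 2"
  have h': "v$1 * w' t $ 1 + v$2 * w' t $ 2 = \<alpha>" for t
    unfolding \<alpha>_def w1' w2'
    by (rule DERIV_isconst_all[of "\<lambda>t. v$1 * (y t $ 1 - k * v$2 * w t $ 3) + v$2 * (y t $ 2 + k * v$1 * w t $ 3)" t 0], rule allI, (rule derivative_eq_intros D refl)+)
       (simp add: y1' y2' algebra_simps)
  have "v$1 * w t $ 1 + v$2 * w t $ 2 - \<alpha> * t = v$1 * w 0 $ 1 + v$2 * w 0 $ 2 - \<alpha> * 0" for t
    by (rule DERIV_isconst_all[of "\<lambda>t. v$1 * w t $ 1 + v$2 * w t $ 2 - \<alpha> * t" t 0]) (auto intro!: derivative_eq_intros D simp: h'[unfolded mult.commute[of "v $ _"]])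
  then have h: "v$1 * w t $ 1 + v$2 * w t $ 2 = \<alpha> * t" for t
    by (simp add: w0)
  then have "\<alpha> = 0" using h[of T] T w0 by simp
  with h have h: "v$1 * w t $ 1 + v$2 * w t $ 2 = 0" for t by simp
  \<comment> \<open>The summand ending in \<open>* 0\<close> keeps the shape of the conserved
    quantity evaluated at time \<open>0\<close>.\<close>
  define \<beta> where "\<beta> = v$1 * w' 0 $ 2 - v$2 * w' 0 $ 1 - 2 * k * r2 * C * 0"
  have P': "v$1 * w' t $ 2 - v$2 * w' t $ 1 - 2 * k * r2 * C * t = \<beta>" for t
    unfolding \<beta>_def w1' w2'
    by (rule DERIV_isconst_all[of "\<lambda>t. v$1 * (y t $ 2 + k * v$1 * w t $ 3) - v$2 * (y t $ 1 - k * v$2 * w t $ 3) - 2 * k * r2 * C * t" t 0], rule allI, (rule derivative_eq_intros D refl)+)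
       (simp add: y1' y2' w3' y3 r2_def algebra_simps power2_eq_square)
  have P'': "v$1 * w' t $ 2 = v$2 * w' t $ 1 + 2 * k * r2 * C * t + \<beta>" for t
    using P'[of t] by simp
  have "P t - (k * r2 * C * t\<^sup>2 + \<beta> * t) = P 0 - (k * r2 * C * 0\<^sup>2 + \<beta> * 0)" for t
    unfolding P_def
    by (rule DERIV_isconst_all[of "\<lambda>t. (v$1 * w t $ 2 - v$2 * w t $ 1) - (k * r2 * C * t\<^sup>2 + \<beta> * t)" t 0])
       (auto intro!: derivative_eq_intros D simp: P'' algebra_simps)
  then have P: "P t = k * r2 * C * t\<^sup>2 + \<beta> * t" for t
    by (simp add: P_def w0)
  have "P T = 0" by (simp add: P_def w0)
  then have "(k * r2 * C * T + \<beta>) * T = 0"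
    unfolding P by (simp add: algebra_simps power2_eq_square)
  \<comment> \<open>Now \<open>P\<close> is proportional to \<open>C\<close>, and integrating
    \<open>w\<^sub>3' = C - 2 k P\<close> makes the vertical component a cubic with factor
    \<open>C\<close>.\<close>
  then have \<beta>: "\<beta> = - k * r2 * C * T" using T by simp
  have "w t $ 3 - (C * t - 2 * k\<^sup>2 * r2 * C * (t^3 / 3 - T * t\<^sup>2 / 2)) =
      w 0 $ 3 - (C * 0 - 2 * k\<^sup>2 * r2 * C * (0^3 / 3 - T * 0\<^sup>2 / 2))" for t
    by (rule DERIV_isconst_all[of "\<lambda>t. w t $ 3 - (C * t - 2 * k\<^sup>2 * r2 * C * (t^3 / 3 - T * t\<^sup>2 / 2))" t 0])
       (auto intro!: derivative_eq_intros D simp: w3' y3 P \<beta> algebra_simps power2_eq_square)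
  then have w3: "w t $ 3 = C * t - 2 * k\<^sup>2 * r2 * C * (t^3 / 3 - T * t\<^sup>2 / 2)" for t
    by (simp add: w0)
  have "C * (T * (1 + k\<^sup>2 * r2 * T\<^sup>2 / 3)) = 0"
    using w3[of T] w0 by (simp add: field_simps power2_eq_square power3_eq_cube)
  moreover have "1 + k\<^sup>2 * r2 * T\<^sup>2 / 3 > 0"
    using r2 by (intro add_pos_nonneg) simp_all
  ultimately have "C = 0" using T by simp
  then have P0: "v$1 * w t $ 2 - v$2 * w t $ 1 = 0" and w3: "w t $ 3 = 0"
    using P[of t] w3[of t] by (simp_all add: P_def \<beta>)
  \<comment> \<open>The horizontal part is recovered from its tangential and normal components, both
    zero.\<close>
  have "r2 * w t $ 1 = v$1 * (v$1 * w t $ 1 + v$2 * w t $ 2) - v$2 * (v$1 * w t $ 2 - v$2 * w t $ 1)"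
    "r2 * w t $ 2 = v$2 * (v$1 * w t $ 1 + v$2 * w t $ 2) + v$1 * (v$1 * w t $ 2 - v$2 * w t $ 1)"
    by (simp_all add: r2_def algebra_simps power2_eq_square)
  with r2 have "w t = 0"
    unfolding h P0 by (simp add: vec_eq_iff forall_3 w3)
  then show ?thesis by (simp add: Jw)
qed

subsection \<open>Smooth functions\<close>

lemma frechet_derivative_eqI:
  "(f has_derivative f') (at x) \<Longrightarrow> frechet_derivative f (at x) v = f' v"
  by (simp add: frechet_derivative_at[symmetric])

text \<open>At the bottom of the recursion differentiability gives continuity. The product rule
  needs this, as it contains undifferentiated factors.\<close>

lemma k_times_cont_diff_Suc_imp: "k_times_cont_diff (Suc k) f \<Longrightarrow> k_times_cont_diff k f"
proof (induction k arbitrary: f)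
  case 0
  then show ?case
    by (auto intro!: continuous_at_imp_continuous_on differentiable_imp_continuous_within)
qed auto

lemma k_times_cont_diff_const: "k_times_cont_diff k (\<lambda>x. c)"
  by (induction k arbitrary: c) (simp_all add: frechet_derivative_const)

lemma k_times_cont_diff_linear: "bounded_linear L \<Longrightarrow> k_times_cont_diff k L"
proof (cases k)
  case (Suc j)
  assume L: "bounded_linear L"
  then have "frechet_derivative L (at x) v = L v" for x v
    by (intro frechet_derivative_eqI bounded_linear_imp_has_derivative)
  with L Suc show ?thesis
    by (simp add: bounded_linear_imp_differentiable k_times_cont_diff_const)
qed (simp add: linear_continuous_on)

lemma k_times_cont_diff_compose_linear:
  assumes "bounded_linear L"
  shows "k_times_cont_diff k f \<Longrightarrow> k_times_cont_diff k (\<lambda>x. L (f x))"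
proof (induction k arbitrary: f)
  case 0
  then show ?case
    using bounded_linear.continuous_on[OF assms] by simp
next
  case (Suc k)
  have *: "((\<lambda>x. L (f x)) has_derivative (\<lambda>v. L (frechet_derivative f (at x) v))) (at x)" for x
    using Suc.prems by (intro bounded_linear.has_derivative[OF assms]) (simp flip: frechet_derivative_works)
  have "(\<lambda>x. frechet_derivative (\<lambda>x. L (f x)) (at x) v) = (\<lambda>x. L (frechet_derivative f (at x) v))" for v
    using frechet_derivative_eqI[OF *] by blast
  with Suc * show ?case by (auto simp: differentiable_def)
qed

lemma k_times_cont_diff_add:
  "k_times_cont_diff k f \<Longrightarrow> k_times_cont_diff k g \<Longrightarrow> k_times_cont_diff k (\<lambda>x. f x + g x)"
proof (induction k arbitrary: f g)
  case (Suc k)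
  have *: "((\<lambda>x. f x + g x) has_derivative
      (\<lambda>v. frechet_derivative f (at x) v + frechet_derivative g (at x) v)) (at x)" for x
    using Suc.prems by (intro has_derivative_add) (simp_all flip: frechet_derivative_works)
  have "(\<lambda>x. frechet_derivative (\<lambda>x. f x + g x) (at x) v) =
      (\<lambda>x. frechet_derivative f (at x) v + frechet_derivative g (at x) v)" for v
    using frechet_derivative_eqI[OF *] by blast
  with Suc * show ?case by (auto simp: differentiable_def)
qed (simp add: continuous_on_add)

lemma k_times_cont_diff_mult:
  fixes f g :: "'a::real_normed_vector \<Rightarrow> real"
  shows "k_times_cont_diff k f \<Longrightarrow> k_times_cont_diff k g \<Longrightarrow> k_times_cont_diff k (\<lambda>x. f x * g x)"
proof (induction k arbitrary: f g)
  case (Suc k)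
  have *: "((\<lambda>x. f x * g x) has_derivative
      (\<lambda>v. f x * frechet_derivative g (at x) v + frechet_derivative f (at x) v * g x)) (at x)" for x
    using Suc.prems by (intro has_derivative_mult) (simp_all flip: frechet_derivative_works)
  have "(\<lambda>x. frechet_derivative (\<lambda>x. f x * g x) (at x) v) =
      (\<lambda>x. f x * frechet_derivative g (at x) v + frechet_derivative f (at x) v * g x)" for v
    using frechet_derivative_eqI[OF *] by blast
  moreover have "k_times_cont_diff k f" "k_times_cont_diff k g"
    using Suc.prems k_times_cont_diff_Suc_imp by blast+
  moreover have "(\<lambda>x. f x * g x) differentiable (at x)" for x
    using * by (rule differentiableI)
  ultimately show ?case
    using Suc by (auto intro!: k_times_cont_diff_add)
qed (simp add: continuous_on_mult)

section \<open>Closure properties of smooth functions\<close>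

lemma smooth_const: "smooth (\<lambda>x. c)"
  by (simp add: smooth_def k_times_cont_diff_const)

lemma smooth_vec_nth: "smooth V \<Longrightarrow> smooth (\<lambda>x. V x $ i)"
  unfolding smooth_def using k_times_cont_diff_compose_linear[OF bounded_linear_vec_nth] by blast

lemma smooth_coordinate: "smooth (\<lambda>x. x $ i)"
  by (simp add: smooth_def k_times_cont_diff_linear bounded_linear_vec_nth)

lemma smooth_add: "smooth f \<Longrightarrow> smooth g \<Longrightarrow> smooth (\<lambda>x. f x + g x)"
  by (simp add: smooth_def k_times_cont_diff_add)

lemma smooth_mult:
  fixes f g :: "'a::real_normed_vector \<Rightarrow> real"
  shows "smooth f \<Longrightarrow> smooth g \<Longrightarrow> smooth (\<lambda>x. f x * g x)"
  by (simp add: smooth_def k_times_cont_diff_mult)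

lemma smooth_minus:
  fixes f :: "'a::real_normed_vector \<Rightarrow> real"
  shows "smooth f \<Longrightarrow> smooth (\<lambda>x. - f x)"
  using smooth_mult[OF smooth_const, of f "-1"] by simp

lemma smooth_diff:
  fixes f g :: "'a::real_normed_vector \<Rightarrow> real"
  shows "smooth f \<Longrightarrow> smooth g \<Longrightarrow> smooth (\<lambda>x. f x - g x)"
  using smooth_add[OF _ smooth_minus, of f g] by simp

lemma smooth_differentiable: "smooth f \<Longrightarrow> f differentiable (at x)"
  unfolding smooth_def using k_times_cont_diff.simps(2) by blast

lemma smooth_continuous: "smooth f \<Longrightarrow> continuous_on UNIV f"
  unfolding smooth_def using k_times_cont_diff.simps(1) by blast

lemma smooth_frechet_derivative: "smooth f \<Longrightarrow> smooth (\<lambda>x. frechet_derivative f (at x) v)"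
  unfolding smooth_def using k_times_cont_diff.simps(2) by blast

lemma smooth_partial: "smooth f \<Longrightarrow> smooth (partial i f)"
  using smooth_frechet_derivative[of f "axis i 1"] by (simp add: partial_def[abs_def])

lemmas smooth_intros = smooth_const smooth_vec_nth smooth_coordinate smooth_add smooth_mult
  smooth_minus smooth_diff smooth_partial

text \<open>The mean value theorem is applied twice, first along \<open>u\<close>, then along
  \<open>v\<close>. The second difference itself is symmetric in \<open>u\<close> and
  \<open>v\<close>.\<close>

lemma second_difference_mvt:
  fixes f :: "'a::real_normed_vector \<Rightarrow> real"
  assumes f: "\<And>y. f differentiable (at y)"
    and g: "\<And>y. (\<lambda>z. frechet_derivative f (at z) u) differentiable (at y)"
    and h: "h > 0"
  shows "\<exists>\<alpha> \<beta>. 0 < \<alpha> \<and> \<alpha> < h \<and> 0 < \<beta> \<and> \<beta> < h \<and>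
    f (x + h *\<^sub>R u + h *\<^sub>R v) - f (x + h *\<^sub>R u) - f (x + h *\<^sub>R v) + f x =
    h * (h * frechet_derivative (\<lambda>z. frechet_derivative f (at z) u) (at (x + \<alpha> *\<^sub>R u + \<beta> *\<^sub>R v)) v)"
proof -
  have D: "((\<lambda>s. F (y + s *\<^sub>R w)) has_real_derivative frechet_derivative F (at (y + s *\<^sub>R w)) w) (at s)"
    if "\<And>y. F differentiable (at y)" for F :: "'a \<Rightarrow> real" and y w s
  proof -
    have "((\<lambda>s. y + s *\<^sub>R w) has_vector_derivative w) (at s)"
      by (auto intro!: derivative_eq_intros)
    moreover have "(F has_derivative frechet_derivative F (at (y + s *\<^sub>R w))) (at (y + s *\<^sub>R w))"
      using that frechet_derivative_works by blast
    ultimately show ?thesis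
      unfolding has_real_derivative_iff_has_vector_derivative
      using vector_derivative_diff_chain_within[of "\<lambda>s. y + s *\<^sub>R w" w s UNIV F]
      by (simp add: o_def has_derivative_at_withinI)
  qed
  define \<phi> where "\<phi> = (\<lambda>s. f ((x + h *\<^sub>R v) + s *\<^sub>R u) - f (x + s *\<^sub>R u))"
  have "\<exists>\<alpha>>0. \<alpha> < h \<and> \<phi> h - \<phi> 0 = (h - 0) *
      (frechet_derivative f (at ((x + h *\<^sub>R v) + \<alpha> *\<^sub>R u)) u - frechet_derivative f (at (x + \<alpha> *\<^sub>R u)) u)"
    using h unfolding \<phi>_def by (intro MVT2 DERIV_diff D f) auto
  then obtain \<alpha> where \<alpha>: "0 < \<alpha>" "\<alpha> < h" and 1: "\<phi> h - \<phi> 0 = h *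
      (frechet_derivative f (at ((x + h *\<^sub>R v) + \<alpha> *\<^sub>R u)) u - frechet_derivative f (at (x + \<alpha> *\<^sub>R u)) u)"
    by auto
  define \<psi> where "\<psi> = (\<lambda>s. frechet_derivative f (at ((x + \<alpha> *\<^sub>R u) + s *\<^sub>R v)) u)"
  have "\<exists>\<beta>>0. \<beta> < h \<and> \<psi> h - \<psi> 0 = (h - 0) *
      frechet_derivative (\<lambda>z. frechet_derivative f (at z) u) (at ((x + \<alpha> *\<^sub>R u) + \<beta> *\<^sub>R v)) v"
    using h unfolding \<psi>_def by (intro MVT2 D g) auto
  then obtain \<beta> where \<beta>: "0 < \<beta>" "\<beta> < h" and 2: "\<psi> h - \<psi> 0 = h *
      frechet_derivative (\<lambda>z. frechet_derivative f (at z) u) (at ((x + \<alpha> *\<^sub>R u) + \<beta> *\<^sub>R v)) v"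
    by auto
  have "\<phi> h - \<phi> 0 = h * (\<psi> h - \<psi> 0)"
    unfolding 1 \<psi>_def by (simp add: add_ac)
  with 2 have "\<phi> h - \<phi> 0 = h * (h *
      frechet_derivative (\<lambda>z. frechet_derivative f (at z) u) (at (x + \<alpha> *\<^sub>R u + \<beta> *\<^sub>R v)) v)"
    by simp
  moreover have "\<phi> h - \<phi> 0 = f (x + h *\<^sub>R u + h *\<^sub>R v) - f (x + h *\<^sub>R u) - f (x + h *\<^sub>R v) + f x"
    by (simp add: \<phi>_def add_ac)
  ultimately show ?thesis
    using \<alpha> \<beta> by metis
qed

text \<open>Both mixed derivatives, taken at points near \<open>x\<close>, equal the same second
  difference quotient; continuity carries the equality to \<open>x\<close>.\<close>

lemma smooth_second_derivative_symmetric: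
  fixes f :: "'a::real_normed_vector \<Rightarrow> real"
  assumes "smooth f"
  shows "frechet_derivative (\<lambda>z. frechet_derivative f (at z) u) (at x) v =
    frechet_derivative (\<lambda>z. frechet_derivative f (at z) v) (at x) u"
proof -
  define G where "G = (\<lambda>u v x. frechet_derivative (\<lambda>z. frechet_derivative f (at z) u) (at x) v)"
  note s = smooth_frechet_derivative[OF assms]
  have G: "isCont (G u v) y" for u v y
    using smooth_continuous[OF smooth_frechet_derivative[OF s]]
    unfolding G_def by (simp add: continuous_on_eq_continuous_at)
  have "\<bar>G u v x - G v u x\<bar> \<le> e" if "e > 0" for e
  proof -
    have "e/2 > 0" using that by simp
    then obtain d1 d2 where d: "d1 > 0" "d2 > 0"
      and d1: "\<And>y. dist y x < d1 \<Longrightarrow> dist (G u v y) (G u v x) < e/2"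
      and d2: "\<And>y. dist y x < d2 \<Longrightarrow> dist (G v u y) (G v u x) < e/2"
      using G[of x u v] G[of x v u] unfolding continuous_at_eps_delta by metis
    \<comment> \<open>The \<open>1\<close> keeps \<open>N\<close> positive for
      \<open>u = v = 0\<close> and makes the final estimate in \<open>near\<close> strict.\<close>
    define N where "N = norm u + norm v + 1"
    define h where "h = min d1 d2 / N"
    have N: "N > 0" by (simp add: N_def add_nonneg_pos)
    then have h: "h > 0" using d by (simp add: h_def)
    have near: "dist (x + \<alpha> *\<^sub>R a + \<beta> *\<^sub>R b) x < min d1 d2"
      if "0 < \<alpha>" "\<alpha> < h" "0 < \<beta>" "\<beta> < h" "norm a + norm b + 1 = N" for \<alpha> \<beta> a b
    proof -
      have "dist (x + \<alpha> *\<^sub>R a + \<beta> *\<^sub>R b) x = norm (\<alpha> *\<^sub>R a + \<beta> *\<^sub>R b)"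
        by (simp add: dist_norm add.assoc)
      also have "\<dots> \<le> \<alpha> * norm a + \<beta> * norm b"
        using that norm_triangle_ineq[of "\<alpha> *\<^sub>R a" "\<beta> *\<^sub>R b"] by simp
      also have "\<dots> \<le> h * norm a + h * norm b"
        using that by (intro add_mono mult_right_mono) auto
      also have "\<dots> < h * N"
        using h unfolding that(5)[symmetric] by (simp add: algebra_simps)
      finally show ?thesis using N by (simp add: h_def)
    qed
    obtain \<alpha> \<beta> where ab: "0 < \<alpha>" "\<alpha> < h" "0 < \<beta>" "\<beta> < h"
      "f (x + h *\<^sub>R u + h *\<^sub>R v) - f (x + h *\<^sub>R u) - f (x + h *\<^sub>R v) + f x =
        h * (h * G u v (x + \<alpha> *\<^sub>R u + \<beta> *\<^sub>R v))"
      using second_difference_mvt[where f = f and u = u and v = v and x = x and h = h,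
          OF smooth_differentiable[OF assms] smooth_differentiable[OF s] h]
      unfolding G_def by blast
    obtain \<alpha>' \<beta>' where ab': "0 < \<alpha>'" "\<alpha>' < h" "0 < \<beta>'" "\<beta>' < h"
      "f (x + h *\<^sub>R v + h *\<^sub>R u) - f (x + h *\<^sub>R v) - f (x + h *\<^sub>R u) + f x =
        h * (h * G v u (x + \<alpha>' *\<^sub>R v + \<beta>' *\<^sub>R u))"
      using second_difference_mvt[where f = f and u = v and v = u and x = x and h = h,
          OF smooth_differentiable[OF assms] smooth_differentiable[OF s] h]
      unfolding G_def by blast
    have "h * (h * G u v (x + \<alpha> *\<^sub>R u + \<beta> *\<^sub>R v)) = h * (h * G v u (x + \<alpha>' *\<^sub>R v + \<beta>' *\<^sub>R u))"
      unfolding ab(5)[symmetric] ab'(5)[symmetric] by (simp add: add_ac)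
    then have eq: "G u v (x + \<alpha> *\<^sub>R u + \<beta> *\<^sub>R v) = G v u (x + \<alpha>' *\<^sub>R v + \<beta>' *\<^sub>R u)"
      using h by simp
    have "dist (G u v (x + \<alpha> *\<^sub>R u + \<beta> *\<^sub>R v)) (G u v x) < e/2"
      using near[OF ab(1-4)] by (intro d1) (simp add: N_def)
    moreover have "dist (G v u (x + \<alpha>' *\<^sub>R v + \<beta>' *\<^sub>R u)) (G v u x) < e/2"
      using near[OF ab'(1-4)] by (intro d2) (simp add: N_def add_ac)
    ultimately show ?thesis
      unfolding eq dist_real_def by linarith
  qed
  then have "\<bar>G u v x - G v u x\<bar> \<le> 0"
    by (rule field_le_epsilon) simp
  then show ?thesis by (simp add: G_def)
qed

lemma partial_commute: "smooth f \<Longrightarrow> partial i (partial j f) p = partial j (partial i f) p"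
  using smooth_second_derivative_symmetric[of f "axis j 1" p "axis i 1"]
  by (simp add: partial_def[abs_def])

lemma partial_zero_imp_constant:
  fixes f :: "real^'n \<Rightarrow> real"
  assumes f: "\<And>p. f differentiable (at p)" and 0: "\<And>i p. partial i f p = 0"
  shows "f p = f q"
proof -
  have "(f has_derivative (\<lambda>h. 0)) (at p)" for p
  proof -
    have D: "(f has_derivative frechet_derivative f (at p)) (at p)"
      using f frechet_derivative_works by blast
    then have lin: "linear (frechet_derivative f (at p))"
      using has_derivative_linear by blast
    have "frechet_derivative f (at p) h = 0" for h
    proof -
      have "frechet_derivative f (at p) h = frechet_derivative f (at p) (\<Sum>i\<in>UNIV. h $ i *s axis i 1)"
        by (simp add: basis_expansion)
      also have "\<dots> = 0"
        using 0 by (simp add: linear_sum[OF lin] scalar_mult_eq_scaleR linear_cmul[OF lin] partial_def)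
      finally show ?thesis .
    qed
    then have "frechet_derivative f (at p) = (\<lambda>h. 0)" by blast
    with D show ?thesis by simp
  qed
  then show ?thesis
    using has_derivative_zero_unique[of UNIV f p q] by auto
qed

subsection \<open>Killing fields\<close>

text \<open>The left-invariant frame acting on functions. In these operators the Killing equations
  have constant coefficients.\<close>

definition frame_deriv :: "real \<Rightarrow> 3 \<Rightarrow> (real^3 \<Rightarrow> real) \<Rightarrow> real^3 \<Rightarrow> real" where
  "frame_deriv k i f = (\<lambda>p. if i = 1 then partial 1 f p - k * p$2 * partial 3 f p
     else if i = 2 then partial 2 f p + k * p$1 * partial 3 f p else partial 3 f p)"

lemma frame_deriv_simps:
  "frame_deriv k 1 f = (\<lambda>p. partial 1 f p - k * p$2 * partial 3 f p)"
  "frame_deriv k 2 f = (\<lambda>p. partial 2 f p + k * p$1 * partial 3 f p)"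
  "frame_deriv k 3 f = partial 3 f"
  by (simp_all add: frame_deriv_def)

lemma smooth_frame_deriv: "smooth f \<Longrightarrow> smooth (frame_deriv k i f)"
  using exhaust_3[of i] by (auto simp: frame_deriv_simps intro!: smooth_intros)

lemma frame_deriv_const [simp]: "frame_deriv k i (\<lambda>p. c) = (\<lambda>p. 0)"
  by (simp add: frame_deriv_def fun_eq_iff)

lemma frame_deriv_minus: "smooth f \<Longrightarrow> frame_deriv k i (\<lambda>p. - f p) = (\<lambda>p. - frame_deriv k i f p)"
  by (simp add: frame_deriv_def fun_eq_iff partial_minus smooth_differentiable)

lemma frame_deriv_lincomb:
  "smooth f \<Longrightarrow> smooth g \<Longrightarrow>
    frame_deriv k i (\<lambda>p. a * f p + b * g p) = (\<lambda>p. a * frame_deriv k i f p + b * frame_deriv k i g p)"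
  by (auto simp add: frame_deriv_def fun_eq_iff partial_simps smooth_differentiable algebra_simps)

text \<open>Second partial derivatives commute, so only the first-order terms given by the Lie
  algebra remain.\<close>

lemma frame_deriv_bracket:
  assumes "smooth f"
  shows "frame_deriv k 1 (frame_deriv k 2 f) p =
      frame_deriv k 2 (frame_deriv k 1 f) p + 2 * k * frame_deriv k 3 f p"
    and "frame_deriv k 1 (frame_deriv k 3 f) p = frame_deriv k 3 (frame_deriv k 1 f) p"
    and "frame_deriv k 2 (frame_deriv k 3 f) p = frame_deriv k 3 (frame_deriv k 2 f) p"
proof -
  have "partial i f differentiable (at p)" for i p
    using assms by (intro smooth_differentiable smooth_partial)
  moreover note partial_commute[OF assms, of 1 2] partial_commute[OF assms, of 1 3]
    partial_commute[OF assms, of 2 3]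
  ultimately show "frame_deriv k 1 (frame_deriv k 2 f) p =
      frame_deriv k 2 (frame_deriv k 1 f) p + 2 * k * frame_deriv k 3 f p"
    "frame_deriv k 1 (frame_deriv k 3 f) p = frame_deriv k 3 (frame_deriv k 1 f) p"
    "frame_deriv k 2 (frame_deriv k 3 f) p = frame_deriv k 3 (frame_deriv k 2 f) p"
    by (simp_all add: frame_deriv_simps partial_simps algebra_simps)
qed

text \<open>These are the Killing equations evaluated on pairs of frame vectors. The terms without
  derivatives stem from \<open>[E\<^sub>1, E\<^sub>2] = 2 k E\<^sub>3\<close>.\<close>

lemma killing_field_frame_eqs:
  fixes k :: real and V :: "real^3 \<Rightarrow> real^3" and f :: "3 \<Rightarrow> real^3 \<Rightarrow> real"
  assumes "killing_field (nil_metric k) V" and f_def: "f = (\<lambda>i p. frame_coords k p (V p) $ i)"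
  shows "smooth (f i)"
    and "frame_deriv k 1 (f 1) p = 0" and "frame_deriv k 2 (f 2) p = 0"
    and "frame_deriv k 3 (f 3) p = 0"
    and "frame_deriv k 2 (f 1) p = - frame_deriv k 1 (f 2) p"
    and "frame_deriv k 1 (f 3) p = - frame_deriv k 3 (f 1) p - 2 * k * f 2 p"
    and "frame_deriv k 2 (f 3) p = - frame_deriv k 3 (f 2) p + 2 * k * f 1 p"
proof -
  have V: "smooth V" using assms by (simp add: killing_field_def)
  note sV = smooth_vec_nth[OF V]
  have f: "f 1 = (\<lambda>p. V p $ 1)" "f 2 = (\<lambda>p. V p $ 2)"
    "f 3 = (\<lambda>p. V p $ 3 - k * (p$1 * V p $ 2 - p$2 * V p $ 1))"
    by (simp_all add: f_def frame_coords_def)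
  have "smooth (f 1)" "smooth (f 2)" "smooth (f 3)"
    unfolding f by (intro smooth_intros sV)+
  then show "smooth (f i)" using exhaust_3[of i] by auto
  note d = smooth_differentiable[OF sV]
  define K where "K = (\<lambda>i j. \<Sum>l\<in>UNIV. V p $ l * partial l (\<lambda>q. nil_metric k q $ i $ j) p
      + nil_metric k p $ l $ j * partial i (\<lambda>q. V q $ l) p
      + nil_metric k p $ i $ l * partial j (\<lambda>q. V q $ l) p)"
  have K: "K i j = 0" for i j
    using assms unfolding killing_field_def K_def by blast
  note exp = K_def sum_3 nil_metric_eq frame_deriv_simps f partial_simps d
  \<comment> \<open>\<open>K\<close> is bilinear in its slots; the frame vectors are
    \<open>\<partial>\<^sub>1 - k p\<^sub>2 \<partial>\<^sub>3\<close>,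
    \<open>\<partial>\<^sub>2 + k p\<^sub>1 \<partial>\<^sub>3\<close> and
    \<open>\<partial>\<^sub>3\<close>.\<close>
  have "K 1 1 - 2 * (k * p$2) * K 1 3 + (k * p$2)\<^sup>2 * K 3 3 = 2 * frame_deriv k 1 (f 1) p"
    by (simp add: exp; simp add: algebra_simps power2_eq_square)
  then show "frame_deriv k 1 (f 1) p = 0" by (simp add: K)
  have "K 2 2 + 2 * (k * p$1) * K 2 3 + (k * p$1)\<^sup>2 * K 3 3 = 2 * frame_deriv k 2 (f 2) p"
    by (simp add: exp; simp add: algebra_simps power2_eq_square)
  then show "frame_deriv k 2 (f 2) p = 0" by (simp add: K)
  have "K 3 3 = 2 * frame_deriv k 3 (f 3) p"
    by (simp add: exp; simp add: algebra_simps power2_eq_square)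
  then show "frame_deriv k 3 (f 3) p = 0" by (simp add: K)
  have "K 1 2 + k * p$1 * K 1 3 - k * p$2 * K 3 2 - k\<^sup>2 * p$1 * p$2 * K 3 3 =
      frame_deriv k 2 (f 1) p + frame_deriv k 1 (f 2) p"
    by (simp add: exp; simp add: algebra_simps power2_eq_square)
  then show "frame_deriv k 2 (f 1) p = - frame_deriv k 1 (f 2) p" by (simp add: K)
  have "K 1 3 - k * p$2 * K 3 3 =
      frame_deriv k 1 (f 3) p - (- frame_deriv k 3 (f 1) p - 2 * k * f 2 p)"
    by (simp add: exp; simp add: algebra_simps power2_eq_square)
  then show "frame_deriv k 1 (f 3) p = - frame_deriv k 3 (f 1) p - 2 * k * f 2 p" by (simp add: K)
  have "K 2 3 + k * p$1 * K 3 3 =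
      frame_deriv k 2 (f 3) p - (- frame_deriv k 3 (f 2) p + 2 * k * f 1 p)"
    by (simp add: exp; simp add: algebra_simps power2_eq_square)
  then show "frame_deriv k 2 (f 3) p = - frame_deriv k 3 (f 2) p + 2 * k * f 1 p" by (simp add: K)
qed

text \<open>The rotation number \<open>\<alpha>\<close> is the function \<open>E\<^sub>1 f\<^sub>2\<close>, where \<open>f\<close> are the components of \<open>V\<close> in the frame \<open>E\<close>.
  It is constant: by the Killing equations \<open>E\<^sub>1 E\<^sub>1 f\<^sub>3\<close>, \<open>E\<^sub>2 E\<^sub>2 f\<^sub>3\<close> and \<open>E\<^sub>2 E\<^sub>1 f\<^sub>3\<close> are multiples of
  \<open>E\<^sub>1 f\<^sub>2\<close> and \<open>E\<^sub>3 E\<^sub>1 f\<^sub>2\<close>, and commuting derivatives of \<open>f\<^sub>3\<close> makes all \<open>E\<^sub>i E\<^sub>1 f\<^sub>2\<close> vanish.\<close>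

lemma killing_field_rotation:
  fixes k :: real and V :: "real^3 \<Rightarrow> real^3"
  assumes V: "killing_field (nil_metric k) V" and k: "k \<noteq> 0"
  shows "\<exists>\<alpha>. \<forall>p q. V q $ 1 - V p $ 1 = - \<alpha> * (q$2 - p$2) \<and> V q $ 2 - V p $ 2 = \<alpha> * (q$1 - p$1)"
proof -
  define f where "f = (\<lambda>i p. frame_coords k p (V p) $ i)"
  let ?E = "frame_deriv k"
  note eqs = killing_field_frame_eqs[OF V f_def]
  note sm = eqs(1)
  note smE = smooth_frame_deriv[OF sm]
  have E11: "?E 1 (f 1) = (\<lambda>p. 0)" and E22: "?E 2 (f 2) = (\<lambda>p. 0)" and E33: "?E 3 (f 3) = (\<lambda>p. 0)"
    using eqs(2-4) by blast+
  define a where "a = ?E 1 (f 2)"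
  have sa: "smooth a" unfolding a_def by (rule smE)
  have E21: "?E 2 (f 1) = (\<lambda>p. - a p)" using eqs(5) unfolding a_def by blast
  have E13: "?E 1 (f 3) = (\<lambda>p. (-1) * ?E 3 (f 1) p + (- 2 * k) * f 2 p)"
    and E23: "?E 2 (f 3) = (\<lambda>p. (-1) * ?E 3 (f 2) p + (2 * k) * f 1 p)"
    using eqs(6,7) by (auto simp: fun_eq_iff)
  note br = frame_deriv_bracket
  have E31: "?E 1 (?E 3 (f 1)) = (\<lambda>p. 0)" and E32: "?E 2 (?E 3 (f 2)) = (\<lambda>p. 0)"
    using br(2)[OF sm[of 1]] br(3)[OF sm[of 2]] by (simp_all add: fun_eq_iff E11 E22)
  have E321: "?E 2 (?E 3 (f 1)) p = - ?E 3 a p" for p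
    using br(3)[OF sm[of 1]] by (simp add: E21 frame_deriv_minus sa)
  have E312: "?E 1 (?E 3 (f 2)) p = ?E 3 a p" for p
    using br(2)[OF sm[of 2]] by (simp add: a_def)
  \<comment> \<open>The summand \<open>0 * a p\<close> provides the shape required by
    \<open>frame_deriv_lincomb\<close>.\<close>
  have E113: "?E 1 (?E 1 (f 3)) = (\<lambda>p. (- 2 * k) * a p + 0 * a p)"
    unfolding E13 frame_deriv_lincomb[OF smE sm] E31 by (simp add: a_def)
  have E223: "?E 2 (?E 2 (f 3)) = (\<lambda>p. (- 2 * k) * a p + 0 * a p)"
    unfolding E23 frame_deriv_lincomb[OF smE sm] E32 by (simp add: E21)
  have E213: "?E 2 (?E 1 (f 3)) p = ?E 3 a p" for p
    unfolding E13 frame_deriv_lincomb[OF smE sm] by (simp add: E321 E22)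
  have E123: "?E 1 (?E 2 (f 3)) p = - ?E 3 a p" for p
    unfolding E23 frame_deriv_lincomb[OF smE sm] by (simp add: E312 E11)
  \<comment> \<open>On \<open>f 3\<close> the bracket relation reads
    \<open>- E\<^sub>3 a = E\<^sub>3 a + 2 k E\<^sub>3 f\<^sub>3\<close>, with last term
    zero.\<close>
  have E3a: "?E 3 a p = 0" for p
    using br(1)[OF sm[of 3], of k p] by (simp add: E213 E123 E33)
  then have E213: "?E 2 (?E 1 (f 3)) = (\<lambda>p. 0)" and E123: "?E 1 (?E 2 (f 3)) = (\<lambda>p. 0)"
    using E213 E123 by (simp_all add: fun_eq_iff)
  have E313: "?E 3 (?E 1 (f 3)) p = 0" and E323: "?E 3 (?E 2 (f 3)) p = 0" for p
    using br(2,3)[OF sm[of 3], of k p] by (simp_all add: E33)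
  have s13: "smooth (?E 1 (f 3))" and s23: "smooth (?E 2 (f 3))"
    by (rule smE)+
  \<comment> \<open>In \<open>E\<^sub>2 E\<^sub>1 E\<^sub>1 f\<^sub>3\<close> the outer two
    operators are exchanged; \<open>E\<^sub>1 E\<^sub>2 E\<^sub>1 f\<^sub>3\<close> and the bracket
    term \<open>E\<^sub>3 E\<^sub>1 f\<^sub>3\<close> both vanish.\<close>
  have E2a: "?E 2 a p = 0" for p
  proof -
    have "(- 2 * k) * ?E 2 a p + 0 * ?E 2 a p = ?E 2 (?E 1 (?E 1 (f 3))) p"
      unfolding E113 by (subst frame_deriv_lincomb[OF sa sa]) simp
    also have "\<dots> = 0"
      using br(1)[OF s13, of k p] by (simp add: E213 E313)
    finally show ?thesis using k by simp
  qed
  have E1a: "?E 1 a p = 0" for p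
  proof -
    have "(- 2 * k) * ?E 1 a p + 0 * ?E 1 a p = ?E 1 (?E 2 (?E 2 (f 3))) p"
      unfolding E223 by (subst frame_deriv_lincomb[OF sa sa]) simp
    also have "\<dots> = 0"
      using br(1)[OF s23, of k p] by (simp add: E123 E323)
    finally show ?thesis using k by simp
  qed
  \<comment> \<open>The second-order terms of the bracket relation on \<open>f 1\<close> are zero,
    which leaves \<open>2 k E\<^sub>3 f\<^sub>1 = 0\<close>.\<close>
  have E31: "?E 3 (f 1) p = 0" for p
    using br(1)[OF sm[of 1], of k p] k by (simp add: E21 E11 frame_deriv_minus sa E1a)
  have E32: "?E 3 (f 2) p = 0" for p
    using br(1)[OF sm[of 2], of k p] k by (simp add: E22 E2a flip: a_def)
  have const: "g p = g q" if "smooth g" and "\<And>i p. ?E i g p = 0" for g p q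
  proof (rule partial_zero_imp_constant[OF smooth_differentiable[OF that(1)]])
    fix i p
    show "partial i g p = 0"
      using exhaust_3[of i] that(2)[of 1 p] that(2)[of 2 p] that(2)[of 3 p]
      by (auto simp: frame_deriv_simps)
  qed
  have all3: "\<forall>i. ?E i g p = 0" if "?E 1 g p = 0" "?E 2 g p = 0" "?E 3 g p = 0" for g p
    using that exhaust_3 by metis
  define \<alpha> where "\<alpha> = a 0"
  have a: "a = (\<lambda>p. \<alpha>)"
  proof
    fix p show "a p = \<alpha>"
      unfolding \<alpha>_def using all3[OF E1a E2a E3a] by (intro const sa) blast
  qed
  have f12: "f 1 = (\<lambda>p. V p $ 1)" "f 2 = (\<lambda>p. V p $ 2)"
    by (simp_all add: f_def frame_coords_def)
  have sx: "smooth (\<lambda>p::real^3. p $ i)" for i by (rule smooth_coordinate)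
  have Ex: "?E 1 (\<lambda>p. p $ 1) = (\<lambda>p. 1)" "?E 1 (\<lambda>p. p $ 2) = (\<lambda>p. 0)" "?E 2 (\<lambda>p. p $ 1) = (\<lambda>p. 0)"
    "?E 2 (\<lambda>p. p $ 2) = (\<lambda>p. 1)" "?E 3 (\<lambda>p. p $ 1) = (\<lambda>p. 0)" "?E 3 (\<lambda>p. p $ 2) = (\<lambda>p. 0)"
    by (simp_all add: frame_deriv_simps fun_eq_iff)
  \<comment> \<open>Removing the rotation from the horizontal components leaves functions with zero
    frame derivatives.\<close>
  have 1: "1 * f 1 q + \<alpha> * q $ 2 = 1 * f 1 p + \<alpha> * p $ 2" for p q
  proof (rule const[of "\<lambda>p. 1 * f 1 p + \<alpha> * p $ 2"])
    show "smooth (\<lambda>p. 1 * f 1 p + \<alpha> * p $ 2)" by (intro smooth_intros sm)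
    show "?E i (\<lambda>p. 1 * f 1 p + \<alpha> * p $ 2) p = 0" for i p
      unfolding frame_deriv_lincomb[OF sm sx]
      using exhaust_3[of i] by (auto simp: Ex E11 E21 E31 a)
  qed
  have 2: "1 * f 2 q + (- \<alpha>) * q $ 1 = 1 * f 2 p + (- \<alpha>) * p $ 1" for p q
  proof (rule const[of "\<lambda>p. 1 * f 2 p + (- \<alpha>) * p $ 1"])
    show "smooth (\<lambda>p. 1 * f 2 p + (- \<alpha>) * p $ 1)" by (intro smooth_intros sm)
    have "?E 1 (f 2) = (\<lambda>p. \<alpha>)" using a a_def by simp
    then show "?E i (\<lambda>p. 1 * f 2 p + (- \<alpha>) * p $ 1) p = 0" for i p
      unfolding frame_deriv_lincomb[OF sm sx]
      using exhaust_3[of i] by (auto simp: Ex E22 E32)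
  qed
  show ?thesis
  proof (intro exI allI conjI)
    show "V q $ 1 - V p $ 1 = - \<alpha> * (q$2 - p$2)" for p q
      using 1[of q p] by (simp add: f12 algebra_simps)
    show "V q $ 2 - V p $ 2 = \<alpha> * (q$1 - p$1)" for p q
      using 2[of q p] by (simp add: f12 algebra_simps)
  qed
qed

text \<open>Zeros on two different fibres force the rotation number to be zero. The horizontal
  components then vanish, the Killing equations make the vertical one constant, and its value at
  \<open>p\<close> is zero.\<close>

lemma killing_field_eq_0:
  assumes V: "killing_field (nil_metric k) V" and k: "k \<noteq> 0"
    and "V p = 0" "V q = 0" and off: "p$1 \<noteq> q$1 \<or> p$2 \<noteq> q$2"
  shows "V r = 0"
proof -
  obtain \<alpha> where \<alpha>: "\<And>p q. V q $ 1 - V p $ 1 = - \<alpha> * (q$2 - p$2)"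
    "\<And>p q. V q $ 2 - V p $ 2 = \<alpha> * (q$1 - p$1)"
    using killing_field_rotation[OF V k] by blast
  have "\<alpha> = 0"
    using \<alpha>(1)[of q p] \<alpha>(2)[of q p] assms(3-5) by auto
  then have V12: "V x $ 1 = 0" "V x $ 2 = 0" for x
    using \<alpha>(1)[of x p] \<alpha>(2)[of x p] assms(3) by auto
  define f where "f = (\<lambda>i p. frame_coords k p (V p) $ i)"
  note eqs = killing_field_frame_eqs[OF V f_def]
  have f12: "f 1 = (\<lambda>p. 0)" "f 2 = (\<lambda>p. 0)" and f3: "f 3 = (\<lambda>p. V p $ 3)"
    using V12 by (simp_all add: f_def frame_coords_def fun_eq_iff)
  have "partial i (f 3) x = 0" for i x
    using eqs(4)[of x] eqs(6)[of x] eqs(7)[of x] exhaust_3[of i]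
    unfolding f12 by (auto simp: frame_deriv_simps)
  then have "f 3 r = f 3 p"
    using partial_zero_imp_constant[OF smooth_differentiable[OF eqs(1)]] by blast
  then show ?thesis
    using V12 assms(3) by (simp add: f3 vec_eq_iff forall_3)
qed

text \<open>The horizontal components depend only on the projection, and
  \<open>E\<^sub>3 f\<^sub>3 = 0\<close> makes the vertical one constant along the fibre.\<close>

lemma killing_field_eq_0_on_fibre:
  assumes V: "killing_field (nil_metric k) V" and k: "k \<noteq> 0"
    and "V p = 0" and on: "q$1 = p$1" "q$2 = p$2"
  shows "V q = 0"
proof -
  obtain \<alpha> where \<alpha>: "\<And>p q. V q $ 1 - V p $ 1 = - \<alpha> * (q$2 - p$2)"
    "\<And>p q. V q $ 2 - V p $ 2 = \<alpha> * (q$1 - p$1)"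
    using killing_field_rotation[OF V k] by blast
  have q12: "V q $ 1 = 0" "V q $ 2 = 0"
    using \<alpha>(1)[of q p] \<alpha>(2)[of q p] assms(3) on by auto
  define f where "f = (\<lambda>i p. frame_coords k p (V p) $ i)"
  note eqs = killing_field_frame_eqs[OF V f_def]
  define g where "g = (\<lambda>s. f 3 (p + s *\<^sub>R axis 3 1))"
  have "(g has_real_derivative 0) (at s)" for s
  proof -
    have "((\<lambda>s. p + s *\<^sub>R axis 3 1) has_vector_derivative axis 3 1) (at s)"
      by (auto intro!: derivative_eq_intros)
    moreover have "(f 3 has_derivative frechet_derivative (f 3) (at (p + s *\<^sub>R axis 3 1)))
        (at (p + s *\<^sub>R axis 3 1))"
      using smooth_differentiable[OF eqs(1)] frechet_derivative_works by blast
    ultimately have "(g has_vector_derivative frechet_derivative (f 3) (at (p + s *\<^sub>R axis 3 1)) (axis 3 1)) (at s)"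
      unfolding g_def
      using vector_derivative_diff_chain_within[of "\<lambda>s. p + s *\<^sub>R axis 3 1" "axis 3 1" s UNIV "f 3"]
      by (simp add: o_def has_derivative_at_withinI)
    moreover have "frechet_derivative (f 3) (at x) (axis 3 1) = 0" for x
      using eqs(4)[of x] by (simp add: frame_deriv_simps partial_def)
    ultimately show ?thesis
      by (simp add: has_real_derivative_iff_has_vector_derivative)
  qed
  then have "g (q$3 - p$3) = g 0"
    by (intro DERIV_isconst_all) blast
  moreover have "p + (q$3 - p$3) *\<^sub>R axis 3 1 = q"
    using on by (simp add: vec_eq_iff forall_3 axis_def)
  ultimately have "f 3 q = f 3 p" by (simp add: g_def)
  then show ?thesis
    using q12 assms(3) by (simp add: f_def frame_coords_def vec_eq_iff forall_3)
qed

subsection \<open>Conjugate points\<close>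

lemma vector_3_eq_0_iff [simp]: "(vector [x, y, z] :: real^3) = 0 \<longleftrightarrow> x = 0 \<and> y = 0 \<and> z = 0"
  by (simp add: vec_eq_iff forall_3)

text \<open>With \<open>C = 0\<close> a horizontal field can run along a circle through zero,
  returning there after each period \<open>2 pi / \<omega>\<close>.\<close>

lemma vertical_helix_conjugate:
  assumes k: "k > 0" and v: "v$1 = 0" "v$2 = 0" "v$3 \<noteq> 0"
  shows "conjugate_along (nil_metric k) UNIV (helix k a v) (pi / (k * v$3))"
proof -
  define \<omega> where "\<omega> = 2 * k * v$3"
  have \<omega>: "\<omega> \<noteq> 0" using k v by (simp add: \<omega>_def)
  have T: "\<omega> * (pi / (k * v$3)) = 2 * pi"
    using k v by (simp add: \<omega>_def)
  define J where "J = (\<lambda>t. frame_vec k (helix k a v t) (vector [sin (\<omega> * t), 1 - cos (\<omega> * t), 0]))"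
  have rot: "rot_vec k v t $ 1 = 0" "rot_vec k v t $ 2 = 0" for t
    using v by (simp_all add: rot_vec_def)
  have "jacobi_field_on (nil_metric k) UNIV (helix k a v) J"
    unfolding J_def
    by (rule jacobi_field_on_helixI[where C = 0 and ?b1.0 = "\<lambda>t. \<omega> * cos (\<omega> * t)"
          and ?b2.0 = "\<lambda>t. \<omega> * sin (\<omega> * t)"])
       (auto intro!: derivative_eq_intros simp: rot \<omega>_def)
  moreover have "J 0 = 0" "J (pi / (k * v$3)) = 0"
    unfolding J_def frame_vec_eq_0_iff T by simp_all
  moreover have "J (pi / 2 / \<omega>) \<noteq> 0"
    using \<omega> by (simp add: J_def)
  ultimately show ?thesis
    using k v by (auto simp: conjugate_along_def)
qed

text \<open>In complex notation the rotating horizontal velocity is \<open>u = u\<^sub>1 + i u\<^sub>2\<close>, and the horizontal part of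
  the Jacobi field is \<open>u (h + i n)\<close> with \<open>h + i n = (A + i B) (1 - e\<^bsup>-i \<omega> t\<^esup>) + D t\<close>. The choice of
  \<open>A\<close>, \<open>B\<close>, \<open>D\<close> makes this vanish at \<open>T = 2 s / \<omega>\<close>; the equation for \<open>s\<close> is then equivalent to the
  vanishing of the vertical component.\<close>

lemma slanted_helix_conjugate:
  assumes k: "k > 0" and v: "v$1 \<noteq> 0 \<or> v$2 \<noteq> 0" "v$3 \<noteq> 0"
  shows "\<exists>T. conjugate_along (nil_metric k) UNIV (helix k a v) T \<and>
    (a$1 \<noteq> helix k a v T $ 1 \<or> a$2 \<noteq> helix k a v T $ 2)"
proof -
  define c where "c = v$3"
  define r2 where "r2 = (v$1)\<^sup>2 + (v$2)\<^sup>2"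
  have c: "c \<noteq> 0" and r2: "r2 > 0"
    using v by (auto simp: c_def r2_def sum_power2_gt_zero_iff)
  define \<omega> where "\<omega> = 2 * k * c"
  have \<omega>: "\<omega> \<noteq> 0" using k c by (simp add: \<omega>_def)
  \<comment> \<open>The expression is \<open>- r2 * pi\<close> at the left end and
    \<open>c\<^sup>2 + r2\<close> at the right end.\<close>
  have "\<exists>s\<ge>pi. s \<le> 3 / 2 * pi \<and> r2 * s * cos s - (c\<^sup>2 + r2) * sin s = 0"
  proof (rule IVT')
    have "sin (3 / 2 * pi) = - 1" "cos (3 / 2 * pi) = 0"
      using sin_periodic_pi[of "pi/2"] cos_periodic_pi[of "pi/2"] by (simp_all add: field_simps)
    then show "0 \<le> r2 * (3 / 2 * pi) * cos (3 / 2 * pi) - (c\<^sup>2 + r2) * sin (3 / 2 * pi)"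
      using r2 by simp
    show "r2 * pi * cos pi - (c\<^sup>2 + r2) * sin pi \<le> 0"
      using r2 by simp
  qed (auto intro!: continuous_intros)
  then obtain s where s: "pi \<le> s" "s \<le> 3 / 2 * pi" and eq: "r2 * s * cos s = (c\<^sup>2 + r2) * sin s"
    by auto
  \<comment> \<open>Excluding \<open>pi\<close> makes \<open>sin s\<close> nonzero, on which both
    the nontriviality of the field and the distance from the fibre depend.\<close>
  have "s \<noteq> pi" using eq r2 by auto
  then have "sin (s - pi) > 0"
    using s by (intro sin_gt_zero) auto
  then have sin: "sin s \<noteq> 0" by simp
  define T where "T = 2 * s / \<omega>"
  have "s > 0" using s pi_gt_zero by linarith
  then have T: "T \<noteq> 0" and \<omega>T: "\<omega> * T = 2 * s" using \<omega> by (simp_all add: T_def)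
  \<comment> \<open>As \<open>1 - e^(-2 i s) = 2 i sin s e^(-i s)\<close>, the choice
    \<open>A + i B = i (T / 2) e^(i s)\<close> turns the first term at \<open>T\<close> into
    \<open>- T sin s\<close>, which \<open>D * T\<close> cancels.\<close>
  define A where "A = - (T / 2 * sin s)"
  define B where "B = T / 2 * cos s"
  define D where "D = sin s"
  define h where "h = (\<lambda>t. A * (1 - cos (\<omega> * t)) - B * sin (\<omega> * t) + D * t)"
  define n where "n = (\<lambda>t. A * sin (\<omega> * t) + B * (1 - cos (\<omega> * t)))"
  define u1 where "u1 = (\<lambda>t. v$1 * cos (\<omega> * t) - v$2 * sin (\<omega> * t))"
  define u2 where "u2 = (\<lambda>t. v$1 * sin (\<omega> * t) + v$2 * cos (\<omega> * t))"
  define w1 where "w1 = (\<lambda>t. u1 t * h t - u2 t * n t)"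
  define w2 where "w2 = (\<lambda>t. u2 t * h t + u1 t * n t)"
  define w3 where "w3 = (\<lambda>t. c * D * t - 2 * k * r2 * (A * vers \<omega> t + B * (t - sinw \<omega> t)))"
  define \<beta> where "\<beta> = (\<lambda>t. \<omega> * A + \<omega> * D * t)"
  \<comment> \<open>\<open>b1 + i b2 = u (D - \<omega> B + i \<beta>)\<close> is the derivative of
    \<open>u (h + i n)\<close>.\<close>
  define b1 where "b1 = (\<lambda>t. u1 t * (D - \<omega> * B) - u2 t * \<beta> t)"
  define b2 where "b2 = (\<lambda>t. u2 t * (D - \<omega> * B) + u1 t * \<beta> t)"
  have Du1: "(u1 has_real_derivative - \<omega> * u2 t) (at t)"
    and Du2: "(u2 has_real_derivative \<omega> * u1 t) (at t)"
    and D\<beta>: "(\<beta> has_real_derivative \<omega> * D) (at t)" for t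
    unfolding u1_def u2_def \<beta>_def by (auto intro!: derivative_eq_intros simp: algebra_simps)
  have Dh: "(h has_real_derivative D - \<omega> * B + \<omega> * n t) (at t)"
    and Dn: "(n has_real_derivative \<beta> t - \<omega> * h t) (at t)" for t
    unfolding h_def n_def \<beta>_def by (auto intro!: derivative_eq_intros simp: algebra_simps)
  have u: "rot_vec k v t $ 1 = u1 t" "rot_vec k v t $ 2 = u2 t" for t
    by (simp_all add: rot_vec_def u1_def u2_def \<omega>_def c_def)
  have "(u1 t)\<^sup>2 + (u2 t)\<^sup>2 = r2 * ((sin (\<omega> * t))\<^sup>2 + (cos (\<omega> * t))\<^sup>2)" for t
    unfolding u1_def u2_def r2_def
    by (simp add: algebra_simps power2_eq_square
        del: sin_cos_squared_add sin_cos_squared_add2 sin_cos_squared_add3)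
  then have ur: "(u1 t)\<^sup>2 + (u2 t)\<^sup>2 = r2" for t by simp
  have P: "u1 t * w2 t - u2 t * w1 t = r2 * n t" for t
    unfolding w1_def w2_def ur[of t, symmetric] by (simp add: algebra_simps power2_eq_square)
  define J where "J = (\<lambda>t. frame_vec k (helix k a v t) (vector [w1 t, w2 t, w3 t]))"
  have "jacobi_field_on (nil_metric k) UNIV (helix k a v) J"
    unfolding J_def
  proof (rule jacobi_field_on_helixI[where C = "c * D" and ?b1.0 = b1 and ?b2.0 = b2])
    fix t
    show "(w1 has_real_derivative b1 t) (at t)" "(w2 has_real_derivative b2 t) (at t)"
      unfolding w1_def w2_def b1_def b2_def
      by (auto intro!: derivative_eq_intros Du1 Du2 Dh Dn simp: algebra_simps)
    show "(w3 has_real_derivative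
        c * D - 2 * k * (rot_vec k v t $ 1 * w2 t - rot_vec k v t $ 2 * w1 t)) (at t)"
      unfolding u P w3_def
      by (auto intro!: derivative_eq_intros DERIV_vers DERIV_sinw simp: n_def algebra_simps)
    show "(b1 has_real_derivative - 2 * k * (v$3 * b2 t + rot_vec k v t $ 2 * (c * D))) (at t)"
      "(b2 has_real_derivative 2 * k * (v$3 * b1 t + rot_vec k v t $ 1 * (c * D))) (at t)"
      unfolding u c_def[symmetric] b1_def b2_def
      by (auto intro!: derivative_eq_intros Du1 Du2 D\<beta> simp: \<omega>_def algebra_simps)
  qed
  moreover have "J 0 = 0"
    by (simp add: J_def w1_def w2_def w3_def h_def n_def vers_def sinw_def)
  moreover have "J T = 0"
  proof -
    have trig: "1 - cos (\<omega> * T) = 2 * (sin s)\<^sup>2" "sin (\<omega> * T) = 2 * sin s * cos s"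
      unfolding \<omega>T by (simp_all add: cos_double_sin sin_double)
    have pyth: "T * sin s * (cos s)\<^sup>2 = T * sin s - T * sin s * (sin s)\<^sup>2"
      by (simp add: cos_squared_eq algebra_simps)
    have hT: "h T = 0"
      unfolding h_def trig A_def B_def D_def using pyth
      by (simp add: algebra_simps power2_eq_square)
    have nT: "n T = 0"
      unfolding n_def trig A_def B_def by (simp add: algebra_simps power2_eq_square)
    have "\<omega> * w3 T = \<omega> * c * D * T - 2 * k * r2 * (A * (2 * (sin s)\<^sup>2) - B * (2 * sin s * cos s) + B * (\<omega> * T))"
      using \<omega> unfolding w3_def vers_def sinw_def trig by (simp add: field_simps)
    also have "A * (2 * (sin s)\<^sup>2) - B * (2 * sin s * cos s) = - (T * sin s)"
      unfolding A_def B_def using pyth by (simp add: algebra_simps power2_eq_square)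
    also have "\<omega> * c * D * T - 2 * k * r2 * (- (T * sin s) + B * (\<omega> * T)) =
        2 * k * T * ((c\<^sup>2 + r2) * sin s - r2 * s * cos s)"
      unfolding \<omega>T unfolding B_def D_def \<omega>_def by (simp add: algebra_simps power2_eq_square)
    finally have "w3 T = 0" using \<omega> eq by simp
    with hT nT show ?thesis
      by (simp add: J_def w1_def w2_def)
  qed
  moreover have "J (2 * pi / \<omega>) \<noteq> 0"
  proof -
    \<comment> \<open>After a full turn only the drift \<open>D * t\<close> along the velocity
      remains.\<close>
    have "\<omega> * (2 * pi / \<omega>) = 2 * pi" using \<omega> by simp
    then have "w1 (2 * pi / \<omega>) = v$1 * (D * (2 * pi / \<omega>))" "w2 (2 * pi / \<omega>) = v$2 * (D * (2 * pi / \<omega>))"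
      unfolding w1_def w2_def u1_def u2_def h_def n_def by simp_all
    then show ?thesis
      using v(1) sin \<omega> by (auto simp: J_def D_def)
  qed
  ultimately have "conjugate_along (nil_metric k) UNIV (helix k a v) T"
    using T by (auto simp: conjugate_along_def)
  moreover have "a$1 \<noteq> helix k a v T $ 1 \<or> a$2 \<noteq> helix k a v T $ 2"
  proof (rule ccontr)
    assume "\<not> ?thesis"
    then have X: "v$1 * sinw \<omega> T - v$2 * vers \<omega> T = 0" and Y: "v$1 * vers \<omega> T + v$2 * sinw \<omega> T = 0"
      by (simp_all add: helix_def Let_def \<omega>_def c_def)
    \<comment> \<open>A return to the fibre would need \<open>cos (2 * s) = 1\<close>, against
      \<open>sin s \<noteq> 0\<close>.\<close>
    have "r2 * vers \<omega> T = v$1 * (v$1 * vers \<omega> T + v$2 * sinw \<omega> T) - v$2 * (v$1 * sinw \<omega> T - v$2 * vers \<omega> T)"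
      by (simp add: r2_def algebra_simps power2_eq_square)
    then have "vers \<omega> T = 0" using r2 unfolding X Y by simp
    then show False
      using \<omega> sin by (simp add: vers_def \<omega>T cos_double_sin)
  qed
  ultimately show ?thesis by blast
qed

section \<open>Which helices are isotropic\<close>

lemma horizontal_helix_no_conjugate:
  assumes "v$3 = 0" "v \<noteq> 0"
  shows "\<not> conjugate_along (nil_metric k) UNIV (helix k a v) t"
  using jacobi_field_on_horizontal_eq_0[OF _ assms] unfolding conjugate_along_def by blast

lemma isotropic_helix_iff_horizontal:
  assumes k: "k > 0" and v: "v \<noteq> 0"
  shows "isotropic_geodesic (nil_metric k) UNIV (helix k a v) \<longleftrightarrow> v$3 = 0"
proof
  assume "v$3 = 0"
  with v show "isotropic_geodesic (nil_metric k) UNIV (helix k a v)"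
    by (simp add: isotropic_geodesic_def horizontal_helix_no_conjugate)
next
  assume iso: "isotropic_geodesic (nil_metric k) UNIV (helix k a v)"
  have killing: "\<exists>V s. killing_field (nil_metric k) V \<and> V a = 0 \<and> V (helix k a v t) = 0 \<and> V (helix k a v s) \<noteq> 0"
    if "conjugate_along (nil_metric k) UNIV (helix k a v) t" for t
    using iso that unfolding isotropic_geodesic_def isotropic_conjugate_along_def
      isotropic_jacobi_field_on_def by (metis UNIV_I helix_0)
  show "v$3 = 0"
  proof (rule ccontr)
    assume v3: "v$3 \<noteq> 0"
    show False
    proof (cases "v$1 = 0 \<and> v$2 = 0")
      case True
      then obtain V s where V: "killing_field (nil_metric k) V" "V a = 0" "V (helix k a v s) \<noteq> 0"
        using killing[OF vertical_helix_conjugate[OF k _ _ v3]] by blast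
      \<comment> \<open>A vertical helix stays in the fibre of \<open>a\<close>, so a Killing field
        vanishing at \<open>a\<close> vanishes along all of it.\<close>
      have "helix k a v s $ 1 = a $ 1" "helix k a v s $ 2 = a $ 2"
        using True by (simp_all add: helix_def Let_def)
      then show False
        using killing_field_eq_0_on_fibre[OF V(1) _ V(2)] V(3) k by simp
    next
      case False
      then obtain T where T: "conjugate_along (nil_metric k) UNIV (helix k a v) T"
          "a$1 \<noteq> helix k a v T $ 1 \<or> a$2 \<noteq> helix k a v T $ 2"
        using slanted_helix_conjugate[OF k _ v3] by blast
      obtain V s where "killing_field (nil_metric k) V" "V a = 0" "V (helix k a v T) = 0"
          "V (helix k a v s) \<noteq> 0"
        using killing[OF T(1)] by blast
      then show False
        using killing_field_eq_0 T(2) k by (metis less_irrefl)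
    qed
  qed
qed

section \<open>Speed and slope angle of helices\<close>

lemma metric_ip_frame_vec:
  "metric_ip (nil_metric k) p (frame_vec k p v) (frame_vec k p w) = v \<bullet> w"
  by (simp add: metric_ip_def frame_vec_def nil_metric_eq inner_vec_def matrix_vector_mult_def sum_3;
      simp add: algebra_simps power2_eq_square)

lemma norm_rot_vec: "rot_vec k v t \<bullet> rot_vec k v t = v \<bullet> v"
proof -
  define \<omega> where "\<omega> = 2 * k * v$3 * t"
  have "rot_vec k v t \<bullet> rot_vec k v t =
      ((v$1)\<^sup>2 + (v$2)\<^sup>2) * ((sin \<omega>)\<^sup>2 + (cos \<omega>)\<^sup>2) + (v$3)\<^sup>2"
    unfolding rot_vec_def \<omega>_def[symmetric]
    by (simp add: inner_vec_def sum_3 algebra_simps power2_eq_square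
        del: sin_cos_squared_add sin_cos_squared_add2 sin_cos_squared_add3)
  also have "\<dots> = v \<bullet> v"
    unfolding sin_cos_squared_add by (simp add: inner_vec_def sum_3 power2_eq_square)
  finally show ?thesis .
qed

lemma unit_speed_helix_iff: "unit_speed_on (nil_metric k) UNIV (helix k a v) \<longleftrightarrow> v \<bullet> v = 1"
  by (simp add: unit_speed_on_def metric_norm_def velocity_helix metric_ip_frame_vec norm_rot_vec)

lemma hopf_field_eq_frame_vec: "hopf_field \<tau> p = frame_vec k p (axis 3 1)"
  by (simp add: hopf_field_def heis_frame_eq frame_vec_def vec_eq_iff forall_3 axis_def)

lemma helix_has_slope_angle_iff:
  assumes "v \<bullet> v = 1"
  shows "has_slope_angle (2 * k) UNIV (helix k a v) \<theta> \<longleftrightarrow> arccos (v$3) = \<theta>"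
proof -
  have "rot_vec k v t $ 3 = v $ 3" for t by (simp add: rot_vec_def)
  then show ?thesis
    using assms
    by (simp add: has_slope_angle_def metric_angle_def metric_norm_def velocity_helix
        hopf_field_eq_frame_vec[of _ _ k] metric_ip_frame_vec norm_rot_vec inner_axis inner_axis_axis
        flip: nil_metric_def)
qed

theorem corollary5p7:
  fixes \<tau> :: real
  assumes "\<tau> > 0"
  shows "(\<forall>I \<gamma>. maximal_geodesic_on (heis_metric \<tau>) I \<gamma> \<and> \<not> \<gamma> constant_on I \<longrightarrow> inj_on \<gamma> I) \<and>
         (\<forall>I \<gamma>. maximal_geodesic_on (heis_metric \<tau>) I \<gamma> \<and> unit_speed_on (heis_metric \<tau>) I \<gamma> \<and> 0 \<in> I \<longrightarrow>
            (isotropic_geodesic (heis_metric \<tau>) I \<gamma> \<longleftrightarrow> has_slope_angle \<tau> I \<gamma> (pi / 2)))"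
proof -
  define k where "k = \<tau> / 2"
  have k: "k > 0" and metric: "heis_metric \<tau> = nil_metric k" and \<tau>: "\<tau> = 2 * k"
    using assms by (auto simp: k_def nil_metric_def)
  show ?thesis
    unfolding metric
  proof (intro conjI allI impI; elim conjE)
    fix I \<gamma>
    assume max: "maximal_geodesic_on (nil_metric k) I \<gamma>" and nc: "\<not> \<gamma> constant_on I"
    obtain a v where I: "I = UNIV" and \<gamma>: "\<gamma> = helix k a v"
      using maximal_geodesic_on_eq_helix[OF max] by blast
    \<comment> \<open>\<open>geodesic_on\<close> admits constant curves; a helix with zero initial
      velocity is one of them.\<close>
    have "v \<noteq> 0"
      using nc by (auto simp: constant_on_def \<gamma> helix_zero)
    then show "inj_on \<gamma> I"
      using inj_helix[OF k] by (simp add: I \<gamma>)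
  next
    fix I \<gamma>
    assume max: "maximal_geodesic_on (nil_metric k) I \<gamma>" and unit: "unit_speed_on (nil_metric k) I \<gamma>"
    obtain a v where I: "I = UNIV" and \<gamma>: "\<gamma> = helix k a v"
      using maximal_geodesic_on_eq_helix[OF max] by blast
    have v: "v \<bullet> v = 1"
      using unit by (simp add: I \<gamma> unit_speed_helix_iff)
    \<comment> \<open>This puts \<open>v$3\<close> in the range where \<open>cos\<close> inverts
      \<open>arccos\<close>.\<close>
    then have "\<bar>v$3\<bar> \<le> 1"
      using component_le_norm_cart[of v 3] by (simp add: norm_eq_sqrt_inner)
    then have "arccos (v$3) = pi / 2 \<longleftrightarrow> v$3 = 0"
      by (metis abs_le_iff arccos_0 cos_arccos cos_pi_half minus_le_iff)
    moreover have "v \<noteq> 0" using v by auto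
    ultimately show "isotropic_geodesic (nil_metric k) I \<gamma> \<longleftrightarrow> has_slope_angle \<tau> I \<gamma> (pi / 2)"
      using isotropic_helix_iff_horizontal[OF k] helix_has_slope_angle_iff[OF v]
      unfolding \<tau> I \<gamma> by simp
  qed
qed

end
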